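(* Let $N=2^n$, $\mathcal H=(\mathbb C^2)^{\otimes n}$, $M>0$, and let $H_0,H_1,\dots,H_m$ be self-adjoint operators on $\mathcal H$. Let $\Gamma\in SU(N)$ be a special unitary operator. Assume that the equation $i\frac{d}{dt}\psi=(H_0+\sum_{j=1}^mu_j(t)H_j)\psi$ is operator controllable, and suppose that there is Quantum Advantage for $\Gamma$, with constant $C$ and integer $p$, so that $T_{\min}(\Gamma)\le Cn^p$. Then, with the same $C$ and $p$, for every $T>0$ the value function satisfies $$ V(T,\Gamma)\le2\|H_0\|^2Cn^p. $$
   Context: For $T>0$ let $\mathscr U^T$ be the set of $u=(u_j)_{j=1}^m$ with $u_j:[0,T]\to\mathbb R$ measurable and $|u_j(t)|\le M$ a.e. For such $u$, let $U$ solve $i\,U'(t)=(H_0+\sum_{j=1}^mu_j(t)H_j)U(t)$, $U(0)=I$. Operator controllable: for every unitary operator $\Gamma$ on $\mathcal H$ there are $T>0$ and $u\in\mathscr U^T$ with $U(T)=\Gamma$. Minimal time: $T_{\min}(\Gamma)=\inf\{T>0:\exists u\in\mathscr U^T,\ U(T)=\Gamma\}$. Quantum Advantage for a computational problem given by $\Gamma$ (one whose best known classical algorithm takes time exponential in $n$) means: there are $T>0$ and $u\in\mathscr U^T$ with $U(T)=\Gamma$, and there exist a constant $C$ and an integer $p$, both independent of $n$, such that $T_{\min}(\Gamma)\le Cn^p$. Value function: $V(T,\Gamma)=\inf_{u\in\mathscr U^T}\frac12\int_0^T\|[U(t)\Gamma^*,H_0]\|^2dt$, where $[\cdot,\cdot]$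 is the commutator and $\|\cdot\|$ is the operator norm induced by the Hilbert norm of $\mathcal H$. *)

theory Defs
  imports
    "HOL-Analysis.Analysis"
    "Jordan_Normal_Form.Determinant"
    "Jordan_Normal_Form.Schur_Decomposition"
begin

text \<open>The state space \<open>(\<complex>\<^sup>2)\<^sup>\<otimes>\<^sup>n\<close> is identified with \<open>\<complex>\<^sup>N\<close>, \<open>N = 2\<^sup>n\<close>, through the orthonormal
  computational basis: the basis state labelled by a bit string of length \<open>n\<close> gets the number in
  \<open>{0..<2\<^sup>n}\<close> with these binary digits. Operators are matrices in
  \<open>carrier_mat (2 ^ n) (2 ^ n)\<close>. The dimension is a term and not a type, so that families of systems
  indexed by \<open>n\<close> can be expressed.\<close>

definition self_adjoint_op :: "nat \<Rightarrow> complex mat \<Rightarrow> bool" where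
  "self_adjoint_op n A \<longleftrightarrow> A \<in> carrier_mat (2 ^ n) (2 ^ n) \<and> mat_adjoint A = A"

definition unitary_op :: "nat \<Rightarrow> complex mat \<Rightarrow> bool" where
  "unitary_op n A \<longleftrightarrow> A \<in> carrier_mat (2 ^ n) (2 ^ n)
     \<and> mat_adjoint A * A = 1\<^sub>m (2 ^ n) \<and> A * mat_adjoint A = 1\<^sub>m (2 ^ n)"

definition special_unitary_op :: "nat \<Rightarrow> complex mat \<Rightarrow> bool" where
  "special_unitary_op n A \<longleftrightarrow> unitary_op n A \<and> Determinant.det A = 1"

definition hilbert_norm :: "complex Matrix.vec \<Rightarrow> real" where
  "hilbert_norm v = sqrt (Re (v \<bullet>c v))"

definition op_norm :: "complex mat \<Rightarrow> real" where
  "op_norm A = (SUP v \<in> {v \<in> carrier_vec (dim_col A). hilbert_norm v = 1}. hilbert_norm (A *\<^sub>v v))"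

definition commutator :: "complex mat \<Rightarrow> complex mat \<Rightarrow> complex mat" where
  "commutator A B = A * B - B * A"

text \<open>The set \<open>\<U>\<^sup>T\<close> of admissible controls \<open>u\<^sub>1, \<dots>, u\<^sub>m\<close>; only the components with index in \<open>{1..m}\<close>
  and their values on \<open>[0,T]\<close> are relevant.\<close>

definition admissible_controls :: "real \<Rightarrow> nat \<Rightarrow> real \<Rightarrow> (nat \<Rightarrow> real \<Rightarrow> real) set" where
  "admissible_controls M m T = {u. \<forall>j\<in>{1..m}.
     u j \<in> borel_measurable (lebesgue_on {0..T}) \<and> (AE t in lebesgue_on {0..T}. \<bar>u j t\<bar> \<le> M)}"

text \<open>\<open>H 0\<close> is the drift; \<open>H 1, \<dots>, H m\<close> are the control operators.\<close>

definition hamiltonian ::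
  "nat \<Rightarrow> nat \<Rightarrow> (nat \<Rightarrow> complex mat) \<Rightarrow> (nat \<Rightarrow> real \<Rightarrow> real) \<Rightarrow> real \<Rightarrow> complex mat" where
  "hamiltonian n m H u t =
     H 0 + mat (2 ^ n) (2 ^ n) (\<lambda>(i, k). \<Sum>j = 1..m. complex_of_real (u j t) * H j $$ (i, k))"

definition abs_cont_on :: "real \<Rightarrow> real \<Rightarrow> (real \<Rightarrow> complex) \<Rightarrow> bool" where
  "abs_cont_on a b f \<longleftrightarrow> (\<forall>\<epsilon>>0. \<exists>\<delta>>0. \<forall>(r::nat) x y.
     (\<forall>k<r. a \<le> x k \<and> x k \<le> y k \<and> y k \<le> b)
     \<and> disjoint_family_on (\<lambda>k. {x k<..<y k}) {..<r}
     \<and> (\<Sum>k<r. y k - x k) < \<delta>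
     \<longrightarrow> (\<Sum>k<r. dist (f (x k)) (f (y k))) < \<epsilon>)"

definition has_mat_derivative ::
  "(real \<Rightarrow> complex mat) \<Rightarrow> complex mat \<Rightarrow> real filter \<Rightarrow> bool" where
  "has_mat_derivative U D F \<longleftrightarrow> (\<forall>i<dim_row D. \<forall>k<dim_col D.
     ((\<lambda>s. U s $$ (i, k)) has_vector_derivative D $$ (i, k)) F)"

text \<open>As controls are merely measurable, \<open>\<i> U' = (H\<^sub>0 + \<Sum>\<^sub>j u\<^sub>j H\<^sub>j) U\<close>, \<open>U(0) = I\<close> is understood in the
  sense of Caratheodory: \<open>U\<close> is absolutely continuous and the equation holds almost everywhere.\<close>

definition propagator ::
  "nat \<Rightarrow> nat \<Rightarrow> (nat \<Rightarrow> complex mat) \<Rightarrow> (nat \<Rightarrow> real \<Rightarrow> real) \<Rightarrow> real \<Rightarrow> (real \<Rightarrow> complex mat) \<Rightarrow> bool" where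
  "propagator n m H u T U \<longleftrightarrow>
     (\<forall>t\<in>{0..T}. U t \<in> carrier_mat (2 ^ n) (2 ^ n))
     \<and> U 0 = 1\<^sub>m (2 ^ n)
     \<and> (\<forall>i<2 ^ n. \<forall>k<2 ^ n. abs_cont_on 0 T (\<lambda>t. U t $$ (i, k)))
     \<and> (AE t in lebesgue_on {0..T}. \<exists>D \<in> carrier_mat (2 ^ n) (2 ^ n).
          has_mat_derivative U D (at t within {0..T})
          \<and> \<i> \<cdot>\<^sub>m D = hamiltonian n m H u t * U t)"

definition reachable_at ::
  "nat \<Rightarrow> real \<Rightarrow> nat \<Rightarrow> (nat \<Rightarrow> complex mat) \<Rightarrow> real \<Rightarrow> complex mat \<Rightarrow> bool" where
  "reachable_at n M m H T \<Gamma> \<longleftrightarrow>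
     (\<exists>u \<in> admissible_controls M m T. \<exists>U. propagator n m H u T U \<and> U T = \<Gamma>)"

definition operator_controllable ::
  "nat \<Rightarrow> real \<Rightarrow> nat \<Rightarrow> (nat \<Rightarrow> complex mat) \<Rightarrow> bool" where
  "operator_controllable n M m H \<longleftrightarrow>
     (\<forall>\<Gamma>. unitary_op n \<Gamma> \<longrightarrow> (\<exists>T>0. reachable_at n M m H T \<Gamma>))"

definition T_min ::
  "nat \<Rightarrow> real \<Rightarrow> nat \<Rightarrow> (nat \<Rightarrow> complex mat) \<Rightarrow> complex mat \<Rightarrow> real" where
  "T_min n M m H \<Gamma> = Inf {T. T > 0 \<and> reachable_at n M m H T \<Gamma>}"

text \<open>Quantum Advantage is a property of a family of systems and targets indexed by the number
  \<open>n\<close> of qubits: \<open>C\<close> and \<open>p\<close> do not depend on \<open>n\<close>. The informal side remark that no good classical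
  algorithm is known is not part of the definition.\<close>

definition quantum_advantage ::
  "real \<Rightarrow> (nat \<Rightarrow> nat) \<Rightarrow> (nat \<Rightarrow> nat \<Rightarrow> complex mat) \<Rightarrow> (nat \<Rightarrow> complex mat) \<Rightarrow> real \<Rightarrow> int \<Rightarrow> bool" where
  "quantum_advantage M m H \<Gamma> C p \<longleftrightarrow> (\<forall>n\<ge>1.
     (\<exists>T>0. reachable_at n M (m n) (H n) T (\<Gamma> n))
     \<and> T_min n M (m n) (H n) (\<Gamma> n) \<le> C * real n powi p)"

definition value_function ::
  "nat \<Rightarrow> real \<Rightarrow> nat \<Rightarrow> (nat \<Rightarrow> complex mat) \<Rightarrow> real \<Rightarrow> complex mat \<Rightarrow> real" where
  "value_function n M m H T \<Gamma> =
     Inf {1 / 2 * (\<integral>t. (op_norm (commutator (U t * mat_adjoint \<Gamma>) (H 0)))\<^sup>2 \<partial>lebesgue_on {0..T})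
          | u U. u \<in> admissible_controls M m T \<and> propagator n m H u T U}"

end

theory Submission
  imports Defs
begin

text \<open>Let \<open>s > 0\<close> be a time at which \<open>\<Gamma>\<close> is reached by some control. If \<open>s < T\<close>, switch the controls
  off after time \<open>s\<close>; then \<open>U(t) \<Gamma>\<^sup>* = exp (- \<i> (t - s) H\<^sub>0)\<close> commutes with \<open>H\<^sub>0\<close>, so nothing is added to
  the cost. If \<open>T \<le> s\<close>, restrict the control to \<open>[0,T]\<close>. As \<open>U(t) \<Gamma>\<^sup>*\<close> is unitary, the commutator has norm
  at most \<open>2 \<parallel>H\<^sub>0\<parallel>\<close>, hence \<open>V(T,\<Gamma>) \<le> 2 \<parallel>H\<^sub>0\<parallel>\<^sup>2 s\<close>; take the infimum over \<open>s\<close>. Unitarity of a Caratheodory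
  solution follows since the entries of \<open>U\<^sup>* U\<close> are absolutely continuous with derivative \<open>0\<close> almost
  everywhere.\<close>

section \<open>Absolutely continuous functions\<close>

text \<open>The systems of intervals that test absolute continuity. Only the open intervals have to
  be disjoint, so neighbours may share endpoints, as the cells of a division do, and degenerate
  intervals are allowed.\<close>

definition short_intervals :: "real \<Rightarrow> real \<Rightarrow> real \<Rightarrow> nat \<Rightarrow> (nat \<Rightarrow> real) \<Rightarrow> (nat \<Rightarrow> real) \<Rightarrow> bool" where
  "short_intervals a b d r x y \<longleftrightarrow> (\<forall>k<r. a \<le> x k \<and> x k \<le> y k \<and> y k \<le> b)
     \<and> disjoint_family_on (\<lambda>k. {x k<..<y k}) {..<r} \<and> (\<Sum>k<r. y k - x k) < d"

lemma abs_cont_on_iff: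
  "abs_cont_on a b f \<longleftrightarrow> (\<forall>e>0. \<exists>d>0. \<forall>r x y. short_intervals a b d r x y \<longrightarrow>
     (\<Sum>k<r. dist (f (x k)) (f (y k))) < e)"
  unfolding abs_cont_on_def short_intervals_def by simp

lemma abs_cont_onD:
  assumes "abs_cont_on a b f" "e > 0"
  obtains d where "d > 0"
    "\<And>r x y. short_intervals a b d r x y \<Longrightarrow> (\<Sum>k<r. dist (f (x k)) (f (y k))) < e"
  using assms unfolding abs_cont_on_iff by blast

lemma abs_cont_on_subinterval:
  assumes "abs_cont_on a b f" "a \<le> c" "d \<le> b"
  shows "abs_cont_on c d f"
  unfolding abs_cont_on_iff
proof (intro allI impI)
  fix e :: real assume "e > 0"
  obtain \<delta> where d: "\<delta> > 0"
    "\<And>r x y. short_intervals a b \<delta> r x y \<Longrightarrow>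
       (\<Sum>k<r. dist (f (x k)) (f (y k))) < e"
    using abs_cont_onD[OF assms(1) \<open>e > 0\<close>] by blast
  show "\<exists>\<delta>>0. \<forall>r x y. short_intervals c d \<delta> r x y \<longrightarrow> (\<Sum>k<r. dist (f (x k)) (f (y k))) < e"
    using d assms(2,3) by (intro exI[of _ \<delta>] conjI allI impI d(2)) (auto simp: short_intervals_def)
qed

text \<open>The common epsilon-delta argument behind the closure properties: an interval system
  short enough for both \<open>f\<close> and \<open>g\<close> is short enough for
  \<open>h\<close>.\<close>

lemma abs_cont_on_dominated:
  assumes f: "abs_cont_on a b f" and g: "abs_cont_on a b g"
    and h: "\<And>x y. x \<in> {a..b} \<Longrightarrow> y \<in> {a..b} \<Longrightarrow> dist (h x) (h y) \<le> K * (dist (f x) (f y) + dist (g x) (g y))"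
  shows "abs_cont_on a b h"
  unfolding abs_cont_on_iff
proof (intro allI impI)
  fix e :: real assume "e > 0"
  \<comment> \<open>The factor \<open>\<bar>K\<bar> + 1\<close> is positive for every real
    \<open>K\<close>, so the division is safe; the 2 splits the allowance between \<open>f\<close>
    and \<open>g\<close>.\<close>
  define e' where "e' = e / (\<bar>K\<bar> + 1) / 2"
  have e': "e' > 0" using \<open>e > 0\<close> by (simp add: e'_def)
  obtain d1 where d1: "d1 > 0"
    "\<And>r x y. short_intervals a b d1 r x y \<Longrightarrow>
       (\<Sum>k<r. dist (f (x k)) (f (y k))) < e'"
    using abs_cont_onD[OF f e'] by blast
  obtain d2 where d2: "d2 > 0"
    "\<And>r x y. short_intervals a b d2 r x y \<Longrightarrow>
       (\<Sum>k<r. dist (g (x k)) (g (y k))) < e'"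
    using abs_cont_onD[OF g e'] by blast
  show "\<exists>\<delta>>0. \<forall>r x y. short_intervals a b \<delta> r x y \<longrightarrow> (\<Sum>k<r. dist (h (x k)) (h (y k))) < e"
  proof (rule exI[of _ "min d1 d2"], intro conjI allI impI)
    fix r :: nat and x y :: "nat \<Rightarrow> real"
    assume *: "short_intervals a b (min d1 d2) r x y"
    have F: "(\<Sum>k<r. dist (f (x k)) (f (y k))) < e'" using * by (intro d1(2)) (auto simp: short_intervals_def)
    have G: "(\<Sum>k<r. dist (g (x k)) (g (y k))) < e'" using * by (intro d2(2)) (auto simp: short_intervals_def)
    have "(\<Sum>k<r. dist (h (x k)) (h (y k)))
        \<le> (\<Sum>k<r. (\<bar>K\<bar> + 1) * (dist (f (x k)) (f (y k)) + dist (g (x k)) (g (y k))))"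
    proof (rule sum_mono)
      fix k assume "k \<in> {..<r}"
      then have "dist (h (x k)) (h (y k)) \<le> K * (dist (f (x k)) (f (y k)) + dist (g (x k)) (g (y k)))"
        using * by (intro h) (auto simp: short_intervals_def intro: order_trans)
      also have "\<dots> \<le> (\<bar>K\<bar> + 1) * (dist (f (x k)) (f (y k)) + dist (g (x k)) (g (y k)))"
        by (intro mult_right_mono) auto
      finally show "dist (h (x k)) (h (y k)) \<le> \<dots>" .
    qed
    also have "\<dots> = (\<bar>K\<bar> + 1) * ((\<Sum>k<r. dist (f (x k)) (f (y k))) + (\<Sum>k<r. dist (g (x k)) (g (y k))))"
      by (simp only: sum_distrib_left[symmetric] sum.distrib)
    also have "\<dots> < (\<bar>K\<bar> + 1) * (e' + e')"
      using F G by (intro mult_strict_left_mono) auto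
    also have "e' + e' = e / (\<bar>K\<bar> + 1)" by (simp only: e'_def field_sum_of_halves)
    also have "(\<bar>K\<bar> + 1) * (e / (\<bar>K\<bar> + 1)) = e" using abs_add_one_gt_zero[of K] by simp
    finally show "(\<Sum>k<r. dist (h (x k)) (h (y k))) < e" .
  qed (use d1(1) d2(1) in auto)
qed

lemma abs_cont_on_lipschitz:
  assumes "\<And>x y. x \<in> {a..b} \<Longrightarrow> y \<in> {a..b} \<Longrightarrow> dist (f x) (f y) \<le> K * \<bar>x - y\<bar>"
  shows "abs_cont_on a b f"
  unfolding abs_cont_on_iff
proof (intro allI impI)
  fix e :: real assume "e > 0"
  \<comment> \<open>Again \<open>\<bar>K\<bar> + 1\<close> replaces \<open>K\<close>, which may be
    zero or negative.\<close>
  define d where "d = e / (\<bar>K\<bar> + 1)"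
  show "\<exists>\<delta>>0. \<forall>r x y. short_intervals a b \<delta> r x y \<longrightarrow> (\<Sum>k<r. dist (f (x k)) (f (y k))) < e"
  proof (rule exI[of _ d], intro conjI allI impI)
    show "d > 0" using \<open>e > 0\<close> by (simp add: d_def)
    fix r :: nat and x y :: "nat \<Rightarrow> real"
    assume *: "short_intervals a b d r x y"
    have "(\<Sum>k<r. dist (f (x k)) (f (y k))) \<le> (\<Sum>k<r. (\<bar>K\<bar> + 1) * (y k - x k))"
    proof (rule sum_mono)
      fix k assume "k \<in> {..<r}"
      then have xy: "a \<le> x k" "x k \<le> y k" "y k \<le> b" using * by (auto simp: short_intervals_def)
      then have "dist (f (x k)) (f (y k)) \<le> K * \<bar>x k - y k\<bar>"
        by (intro assms) auto
      also have "\<dots> \<le> (\<bar>K\<bar> + 1) * (y k - x k)"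
        using xy by (intro mult_mono) auto
      finally show "dist (f (x k)) (f (y k)) \<le> \<dots>" .
    qed
    also have "\<dots> = (\<bar>K\<bar> + 1) * (\<Sum>k<r. y k - x k)"
      by (simp add: sum_distrib_left)
    also have "\<dots> < (\<bar>K\<bar> + 1) * d"
      using * by (intro mult_strict_left_mono) (auto simp: short_intervals_def)
    also have "\<dots> = e" unfolding d_def by (simp add: field_simps)
    finally show "(\<Sum>k<r. dist (f (x k)) (f (y k))) < e" .
  qed
qed

section \<open>Constants, sums, conjugates and products\<close>

lemma abs_cont_on_const: "abs_cont_on a b (\<lambda>_. c)"
  by (rule abs_cont_on_lipschitz[of _ _ _ 0]) auto

lemma abs_cont_on_add:
  assumes "abs_cont_on a b f" "abs_cont_on a b g"
  shows "abs_cont_on a b (\<lambda>x. f x + g x)"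
  by (rule abs_cont_on_dominated[OF assms, of _ 1]) (simp add: dist_triangle_add)

lemma abs_cont_on_sum:
  assumes "\<And>i. i \<in> I \<Longrightarrow> abs_cont_on a b (f i)"
  shows "abs_cont_on a b (\<lambda>x. \<Sum>i\<in>I. f i x)"
  using assms by (induction I rule: infinite_finite_induct) (auto intro: abs_cont_on_const abs_cont_on_add)

lemma abs_cont_on_cnj:
  assumes "abs_cont_on a b f"
  shows "abs_cont_on a b (\<lambda>x. cnj (f x))"
  by (rule abs_cont_on_dominated[OF assms assms, of _ 1])
    (simp add: dist_norm flip: complex_cnj_diff)

lemma abs_cont_on_continuous:
  assumes "abs_cont_on a b f"
  shows "continuous_on {a..b} f"
  unfolding continuous_on_iff
proof (intro ballI allI impI)
  fix t e :: real assume t: "t \<in> {a..b}" and "e > 0"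
  obtain d where d: "d > 0"
    "\<And>r x y. short_intervals a b d r x y \<Longrightarrow>
       (\<Sum>k<r. dist (f (x k)) (f (y k))) < e"
    using abs_cont_onD[OF assms \<open>e > 0\<close>] by blast
  have "dist (f s) (f t) < e" if s: "s \<in> {a..b}" "dist s t < d" for s
  proof -
    \<comment> \<open>A system of one interval; \<open>min\<close> and \<open>max\<close> cover both
      orders of \<open>s\<close> and \<open>t\<close>.\<close>
    have "short_intervals a b d 1 (\<lambda>_. min s t) (\<lambda>_. max s t)"
      using s t by (auto simp: short_intervals_def disjoint_family_on_def dist_real_def)
    from d(2)[OF this] show ?thesis by (cases "s \<le> t") (auto simp: dist_commute)
  qed
  then show "\<exists>d>0. \<forall>x'\<in>{a..b}. dist x' t < d \<longrightarrow> dist (f x') (f t) < e"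
    using d(1) by blast
qed

text \<open>The increment of a product is a combination of the increments of its factors, with
  coefficients bounded because continuous functions are bounded on a compact interval.\<close>

lemma abs_cont_on_mult:
  assumes f: "abs_cont_on a b f" and g: "abs_cont_on a b g"
  shows "abs_cont_on a b (\<lambda>x. f x * g x)"
proof -
  have "bounded (f ` {a..b})" "bounded (g ` {a..b})"
    using f g by (auto intro!: compact_imp_bounded compact_continuous_image abs_cont_on_continuous)
  then obtain B C where B: "\<And>x. x \<in> {a..b} \<Longrightarrow> norm (f x) \<le> B" and C: "\<And>x. x \<in> {a..b} \<Longrightarrow> norm (g x) \<le> C"
    unfolding bounded_iff by (metis imageI)
  show ?thesis
  proof (rule abs_cont_on_dominated[OF f g, of _ "max B C"])
    fix x y assume xy: "x \<in> {a..b}" "y \<in> {a..b}"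
    have "f x * g x - f y * g y = (f x - f y) * g x + f y * (g x - g y)"
      by (simp add: algebra_simps)
    then have "dist (f x * g x) (f y * g y) \<le> norm (f x - f y) * norm (g x) + norm (f y) * norm (g x - g y)"
      unfolding dist_norm by (metis norm_mult norm_triangle_ineq)
    also have "\<dots> \<le> norm (f x - f y) * max B C + max B C * norm (g x - g y)"
      using B[OF xy(2)] C[OF xy(1)] by (intro add_mono mult_left_mono mult_right_mono) auto
    finally show "dist (f x * g x) (f y * g y) \<le> max B C * (dist (f x) (f y) + dist (g x) (g y))"
      by (simp add: dist_norm algebra_simps)
  qed
qed

text \<open>A monotone map that does not stretch lengths carries test systems to test systems. It is
  applied to the clamps \<open>min t c\<close> and \<open>max t c\<close> and to the shift
  \<open>t - c\<close>.\<close>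

lemma abs_cont_on_compose_mono:
  assumes f: "abs_cont_on c d f" and \<phi>: "mono_on {a..b} \<phi>" "\<phi> ` {a..b} \<subseteq> {c..d}"
    and lip: "\<And>x y. a \<le> x \<Longrightarrow> x \<le> y \<Longrightarrow> y \<le> b \<Longrightarrow> \<phi> y - \<phi> x \<le> y - x"
  shows "abs_cont_on a b (\<lambda>x. f (\<phi> x))"
  unfolding abs_cont_on_iff
proof (intro allI impI)
  fix e :: real assume "e > 0"
  obtain \<delta> where d: "\<delta> > 0"
    "\<And>r x y. short_intervals c d \<delta> r x y \<Longrightarrow>
       (\<Sum>k<r. dist (f (x k)) (f (y k))) < e"
    using abs_cont_onD[OF f \<open>e > 0\<close>] by blast
  show "\<exists>\<delta>>0. \<forall>r x y. short_intervals a b \<delta> r x y \<longrightarrow> (\<Sum>k<r. dist (f (\<phi> (x k))) (f (\<phi> (y k)))) < e"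
  proof (rule exI[of _ \<delta>], intro conjI allI impI)
    fix r :: nat and x y :: "nat \<Rightarrow> real"
    assume *: "short_intervals a b \<delta> r x y"
    have mem: "x k \<in> {a..b}" "y k \<in> {a..b}" "x k \<le> y k" if "k < r" for k
      using * that by (auto simp: short_intervals_def intro: order_trans)
    show "(\<Sum>k<r. dist (f (\<phi> (x k))) (f (\<phi> (y k)))) < e"
    proof (rule d(2), unfold short_intervals_def, intro conjI allI impI)
      show "c \<le> \<phi> (x k)" "\<phi> (x k) \<le> \<phi> (y k)" "\<phi> (y k) \<le> d" if "k < r" for k
        using mem[OF that] \<phi>(2) mono_onD[OF \<phi>(1), of "x k" "y k"]
        by (auto simp: image_subset_iff)
      show "disjoint_family_on (\<lambda>k. {\<phi> (x k)<..<\<phi> (y k)}) {..<r}"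
        unfolding disjoint_family_on_def
      proof (intro ballI impI)
        fix k l assume kl: "k \<in> {..<r}" "l \<in> {..<r}" "k \<noteq> l"
        then have disj: "{x k<..<y k} \<inter> {x l<..<y l} = {}"
          using * unfolding short_intervals_def disjoint_family_on_def by auto
        \<comment> \<open>Disjoint open intervals are ordered unless one is empty. A monotone map
          preserves the order, and an interval with equal endpoints has an empty image
          interval.\<close>
        have "y k \<le> x l \<or> y l \<le> x k \<or> x k = y k \<or> x l = y l"
        proof (rule ccontr)
          assume "\<not> ?thesis"
          then have "max (x k) (x l) < min (y k) (y l)" 
            using mem(3)[of k] mem(3)[of l] kl by auto
          then obtain z where "max (x k) (x l) < z" "z < min (y k) (y l)" using dense by blast
          then have "z \<in> {x k<..<y k} \<inter> {x l<..<y l}" by auto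
          then show False using disj by auto
        qed
        moreover have "\<phi> (y k) \<le> \<phi> (x l)" if "y k \<le> x l"
          using mono_onD[OF \<phi>(1) mem(2) mem(1) that] kl by simp
        moreover have "\<phi> (y l) \<le> \<phi> (x k)" if "y l \<le> x k"
          using mono_onD[OF \<phi>(1) mem(2) mem(1) that] kl by simp
        ultimately show "{\<phi> (x k)<..<\<phi> (y k)} \<inter> {\<phi> (x l)<..<\<phi> (y l)} = {}" by auto
      qed
      have "(\<Sum>k<r. \<phi> (y k) - \<phi> (x k)) \<le> (\<Sum>k<r. y k - x k)"
        using mem by (intro sum_mono lip) auto
      then show "(\<Sum>k<r. \<phi> (y k) - \<phi> (x k)) < \<delta>" using * by (auto simp: short_intervals_def)
    qed
  qed (use d in auto)
qed

lemma abs_cont_on_cong: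
  assumes "abs_cont_on a b f" "\<And>x. x \<in> {a..b} \<Longrightarrow> f x = g x"
  shows "abs_cont_on a b g"
  by (rule abs_cont_on_dominated[OF assms(1,1), of _ 1]) (simp add: assms(2))

lemma abs_cont_on_join:
  assumes f: "abs_cont_on a c f" and g: "abs_cont_on c b g" and "f c = g c" "a \<le> c" "c \<le> b"
  shows "abs_cont_on a b (\<lambda>t. if t \<le> c then f t else g t)"
proof (rule abs_cont_on_cong)
  \<comment> \<open>Clamping removes the case distinction: left of \<open>c\<close> the two terms
    with \<open>g\<close> cancel, right of \<open>c\<close> the constant \<open>f c = g c\<close>
    does.\<close>
  show "abs_cont_on a b (\<lambda>t. f (min t c) + g (max t c) + (- g c))"
    using assms(4,5)
    by (intro abs_cont_on_add abs_cont_on_const abs_cont_on_compose_mono[OF f] abs_cont_on_compose_mono[OF g])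
      (auto intro!: mono_onI)
qed (use assms(3) in auto)

text \<open>Along a fine tagged division whose gauge is differentiability off the exceptional null set and a
  small open cover of it on that set, the increments with tag off the set are small by the derivative,
  and the others by absolute continuity.\<close>

lemma abs_cont_on_derivative_zero:
  assumes f: "abs_cont_on a b f" and "a \<le> b"
    and ae: "AE t in lebesgue_on {a..b}. (f has_vector_derivative 0) (at t within {a..b})"
  shows "f b = f a"
proof -
  define E where "E = {t \<in> {a..b}. \<not> (f has_vector_derivative 0) (at t within {a..b})}"
  have "AE t in lebesgue. t \<notin> E"
    using ae by (auto simp: AE_restrict_space_iff E_def elim: eventually_mono)
  \<comment> \<open>Measurability of \<open>E\<close> itself is not at hand; the open cover is taken
    of a measurable null set around it.\<close>
  then obtain N where N: "E \<subseteq> N" "emeasure lebesgue N = 0" "N \<in> sets lebesgue"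
    by (auto elim!: AE_E)
  have bound: "dist (f a) (f b) \<le> e * (1 + (b - a))" if "e > 0" for e
  proof -
    obtain d where d: "d > 0"
      "\<And>r x y. short_intervals a b d r x y \<Longrightarrow>
         (\<Sum>k<r. dist (f (x k)) (f (y k))) < e"
      using abs_cont_onD[OF f \<open>e > 0\<close>] by blast
    \<comment> \<open>Outer regularity: the null set has an open superset of measure below
      \<open>d\<close>, the total length for which absolute continuity guarantees variation below
      \<open>e\<close>.\<close>
    obtain G where G: "open G" "N \<subseteq> G" "G - N \<in> lmeasurable" "emeasure lebesgue (G - N) < ennreal d"
      using sets_lebesgue_outer_open[OF N(3) d(1)] by metis
    have "G = N \<union> (G - N)" using G by auto
    then have "emeasure lebesgue G \<le> emeasure lebesgue N + emeasure lebesgue (G - N)"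
      using N(3) G(3) by (metis emeasure_subadditive fmeasurableD)
    then have emG: "emeasure lebesgue G < ennreal d" using N(2) G(4) by auto
    then have Gm: "G \<in> lmeasurable" 
      using G(1) by (intro fmeasurableI) (auto simp: less_top intro: order.strict_trans2 top_greatest)
    have mG: "measure lebesgue G < d"
      using emG Gm d(1) by (simp add: emeasure_eq_measure2 ennreal_less_iff)
    have "\<exists>\<rho>>0. \<forall>s\<in>{a..b}. dist s t < \<rho> \<longrightarrow> dist (f s) (f t) \<le> e * \<bar>s - t\<bar>"
      if "t \<in> {a..b} - E" for t
    proof -
      have "(f has_derivative (\<lambda>x. 0)) (at t within {a..b})"
        using that by (auto simp: E_def has_vector_derivative_def)
      then show ?thesis
        using \<open>e > 0\<close> unfolding has_derivative_within_alt by (auto simp: dist_norm)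
    qed
    then obtain \<rho> where \<rho>: "\<And>t. t \<in> {a..b} - E \<Longrightarrow> \<rho> t > 0"
      "\<And>t s. t \<in> {a..b} - E \<Longrightarrow> s \<in> {a..b} \<Longrightarrow> dist s t < \<rho> t \<Longrightarrow> dist (f s) (f t) \<le> e * \<bar>s - t\<bar>"
      by metis
    \<comment> \<open>Cells tagged in \<open>E\<close> must lie in \<open>G\<close>, the others in a
      ball on which the zero derivative is effective. \<open>UNIV\<close> merely completes the gauge
      outside \<open>{a..b}\<close>, where no tag lies.\<close>
    define \<gamma> where "\<gamma> t = (if t \<in> E then G else if t \<in> {a..b} then ball t (\<rho> t) else UNIV)" for t
    have "gauge \<gamma>"
      using \<rho>(1) G N(1) by (auto simp: gauge_def \<gamma>_def)
    then obtain p where p: "p tagged_division_of {a..b}" "\<gamma> fine p"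
      using fine_division_exists_real by blast
    have fin: "finite p" using p(1) by auto
    have K: "\<exists>u v. K = {u..v} \<and> a \<le> u \<and> u \<le> t \<and> t \<le> v \<and> v \<le> b" if "(t, K) \<in> p" for t K
      using tagged_division_ofD(2-4)[OF p(1) that] by fastforce
    define p1 where "p1 = {(t, K) \<in> p. t \<in> E}"
    have fin1: "finite p1" using fin by (auto simp: p1_def intro: finite_subset)
    have "p1 \<subseteq> p" by (auto simp: p1_def)
    define \<Delta> where "\<Delta> = (\<lambda>(t::real, K::real set). dist (f (Inf K)) (f (Sup K)))"
    \<comment> \<open>Cells tagged in \<open>E\<close> do not overlap and lie in \<open>G\<close>,
      so their total length is below \<open>d\<close>. The enumeration \<open>h\<close> gives the
      indexed form that absolute continuity expects.\<close>
    have E1: "(\<Sum>z\<in>p1. \<Delta> z) \<le> e"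
    proof -
      obtain h where h: "bij_betw h {0..<card p1} p1"
        using ex_bij_betw_nat_finite[OF fin1] by blast
      define r where "r = card p1"
      have h': "bij_betw h {..<r} p1" using h by (simp add: r_def lessThan_atLeast0)
      define x where "x k = Inf (snd (h k))" for k
      define y where "y k = Sup (snd (h k))" for k
      have hk: "a \<le> x k \<and> x k \<le> y k \<and> y k \<le> b \<and> snd (h k) = {x k..y k} \<and> {x k..y k} \<subseteq> G" if "k < r" for k
      proof -
        have "h k \<in> p1" using h' that by (auto dest: bij_betwE)
        then obtain t L where tL: "h k = (t, L)" "(t, L) \<in> p" "t \<in> E" by (auto simp: p1_def)
        obtain u v where "L = {u..v}" "a \<le> u" "u \<le> t" "t \<le> v" "v \<le> b" using K[OF tL(2)] by blast
        moreover have "L \<subseteq> G" using fineD[OF p(2) tL(2)] tL(3) by (simp add: \<gamma>_def)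
        ultimately show ?thesis using tL by (auto simp: x_def y_def)
      qed
      have disj: "disjoint_family_on (\<lambda>k. {x k<..<y k}) {..<r}"
        unfolding disjoint_family_on_def
      proof (intro ballI impI)
        fix k l assume kl: "k \<in> {..<r}" "l \<in> {..<r}" "k \<noteq> l"
        have "h k \<noteq> h l" using h' kl by (auto simp: bij_betw_def inj_on_def)
        moreover have "h k \<in> p" "h l \<in> p" using h' kl \<open>p1 \<subseteq> p\<close> by (auto dest: bij_betwE)
        ultimately have "interior (snd (h k)) \<inter> interior (snd (h l)) = {}"
          using tagged_division_ofD(5)[OF p(1)] by (metis prod.collapse)
        then show "{x k<..<y k} \<inter> {x l<..<y l} = {}" using hk[of k] hk[of l] kl by auto
      qed
      have "(\<Sum>k<r. y k - x k) = (\<Sum>k<r. measure lebesgue {x k<..<y k})"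
        using hk by (intro sum.cong) auto
      also have "\<dots> = measure lebesgue (\<Union>k<r. {x k<..<y k})"
        using disj by (intro measure_UNION'[symmetric])
          (auto simp: disjoint_family_on_def pairwise_def disjnt_def)
      also have "\<dots> \<le> measure lebesgue G"
        using hk by (intro measure_mono_fmeasurable[OF _ _ Gm]) force+
      finally have "(\<Sum>k<r. y k - x k) < d" using mG by simp
      then have "(\<Sum>k<r. dist (f (x k)) (f (y k))) < e"
        using hk disj by (intro d(2)) (auto simp: short_intervals_def)
      also have "(\<Sum>k<r. dist (f (x k)) (f (y k))) = (\<Sum>z\<in>p1. \<Delta> z)"
        by (subst sum.reindex_bij_betw[OF h', symmetric]) (auto simp: \<Delta>_def x_def y_def split_def)
      finally show ?thesis by simp
    qed
    \<comment> \<open>The tag \<open>t\<close> splits its cell \<open>{u..v}\<close>: the two pieces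
      contribute at most \<open>e * (t - u)\<close> and \<open>e * (v - t)\<close>, and the lengths
      of all cells of \<open>p\<close> add up to \<open>b - a\<close>.\<close>
    have E2: "(\<Sum>z\<in>p - p1. \<Delta> z) \<le> e * (b - a)"
    proof -
      have "(\<Sum>z\<in>p - p1. \<Delta> z) \<le> (\<Sum>z\<in>p - p1. e * (Sup (snd z) - Inf (snd z)))"
      proof (rule sum_mono)
        fix z assume "z \<in> p - p1"
        then obtain t L where tL: "z = (t, L)" "(t, L) \<in> p" "t \<notin> E" by (cases z) (auto simp: p1_def)
        obtain u v where uv: "L = {u..v}" "a \<le> u" "u \<le> t" "t \<le> v" "v \<le> b" using K[OF tL(2)] by blast
        have "L \<subseteq> ball t (\<rho> t)" using fineD[OF p(2) tL(2)] tL(3) uv by (simp add: \<gamma>_def)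
        then have "u \<in> ball t (\<rho> t)" "v \<in> ball t (\<rho> t)" using uv by (auto simp: subset_iff)
        then have "dist (f u) (f t) \<le> e * \<bar>u - t\<bar>" "dist (f v) (f t) \<le> e * \<bar>v - t\<bar>"
          using uv tL \<rho>(2)[of t u] \<rho>(2)[of t v] by (auto simp: dist_commute)
        moreover have "dist (f u) (f v) \<le> dist (f u) (f t) + dist (f v) (f t)"
          by (rule dist_triangle2)
        ultimately show "\<Delta> z \<le> e * (Sup (snd z) - Inf (snd z))"
          using uv tL by (auto simp: \<Delta>_def algebra_simps)
      qed
      also have "\<dots> \<le> (\<Sum>z\<in>p. e * (Sup (snd z) - Inf (snd z)))"
        using fin \<open>e > 0\<close> K by (intro sum_mono2) fastforce+
      also have "\<dots> = e * (b - a)"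
        using additive_tagged_division_1[OF \<open>a \<le> b\<close> p(1), of "\<lambda>x. x"]
        by (simp add: split_def flip: sum_distrib_left)
      finally show ?thesis .
    qed
    have "f b - f a = (\<Sum>(t, K)\<in>p. f (Sup K) - f (Inf K))"
      using additive_tagged_division_1[OF \<open>a \<le> b\<close> p(1), of f] by simp
    then have "dist (f a) (f b) \<le> (\<Sum>z\<in>p. \<Delta> z)"
      unfolding dist_norm \<Delta>_def
      by (subst norm_minus_commute) (auto intro!: sum_norm_le simp: split_def norm_minus_commute)
    also have "\<dots> = (\<Sum>z\<in>p - p1. \<Delta> z) + (\<Sum>z\<in>p1. \<Delta> z)"
      using fin \<open>p1 \<subseteq> p\<close> by (rule sum.subset_diff[rotated])
    finally show ?thesis using E1 E2 by (simp add: algebra_simps)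
  qed
  have "dist (f a) (f b) \<le> 0"
  proof (rule field_le_epsilon)
    fix e :: real assume "e > 0"
    then show "dist (f a) (f b) \<le> 0 + e"
      using bound[of "e / (1 + (b - a))"] \<open>a \<le> b\<close> by simp
  qed
  then show ?thesis by simp
qed

section \<open>Adjoints and the operator norm\<close>

lemma mat_adjoint_dim [simp]:
  "dim_row (mat_adjoint A) = dim_col A" "dim_col (mat_adjoint A) = dim_row A"
  by (simp_all add: mat_adjoint_def)

lemma mat_adjoint_carrier [simp]:
  "A \<in> carrier_mat nr nc \<Longrightarrow> mat_adjoint A \<in> carrier_mat nc nr"
  by (intro carrier_matI) auto

lemma mat_adjoint_index [simp]:
  "i < dim_col A \<Longrightarrow> j < dim_row A \<Longrightarrow> mat_adjoint A $$ (i, j) = conjugate (A $$ (j, i))"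
  by (simp add: mat_adjoint_def mat_of_rows_index)

lemma mat_adjoint_mat_adjoint [simp]: "mat_adjoint (mat_adjoint A) = A"
  by (rule eq_matI) auto

lemma mat_mult_index:
  "A \<in> carrier_mat nr n \<Longrightarrow> B \<in> carrier_mat n nc \<Longrightarrow> i < nr \<Longrightarrow> j < nc \<Longrightarrow>
    (A * B) $$ (i, j) = (\<Sum>k<n. A $$ (i, k) * B $$ (k, j))"
  by (simp add: scalar_prod_def lessThan_atLeast0)

lemma mat_vec_mult_index:
  "A \<in> carrier_mat nr n \<Longrightarrow> v \<in> carrier_vec n \<Longrightarrow> i < nr \<Longrightarrow>
    vec_index (A *\<^sub>v v) i = (\<Sum>k<n. A $$ (i, k) * vec_index v k)"
  by (simp add: scalar_prod_def lessThan_atLeast0)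

lemma mat_adjoint_mult:
  fixes A :: "complex mat"
  assumes "A \<in> carrier_mat nr n" "B \<in> carrier_mat n nc"
  shows "mat_adjoint (A * B) = mat_adjoint B * mat_adjoint A"
  using assms
  by (intro eq_matI) (auto simp: mat_mult_index[of _ nr n _ nc] mat_mult_index[of _ nc n _ nr] mult.commute simp del: index_mult_mat(1))

text \<open>Makes the monotonicity and the triangle inequality of \<open>L2_set\<close> available
  for the Hilbert norm.\<close>

lemma hilbert_norm_eq:
  "hilbert_norm v = L2_set (\<lambda>i. cmod (vec_index v i)) {..<dim_vec v}"
  by (auto simp: hilbert_norm_def L2_set_def scalar_prod_def lessThan_atLeast0 complex_mult_cnj cmod_power2
      intro!: sum.cong)

lemma hilbert_norm_nonneg: "0 \<le> hilbert_norm v"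
  by (simp add: hilbert_norm_eq L2_set_nonneg)

lemma hilbert_norm_diff_le:
  assumes "v \<in> carrier_vec n" "w \<in> carrier_vec n"
  shows "hilbert_norm (v - w) \<le> hilbert_norm v + hilbert_norm w"
proof -
  have "hilbert_norm (v - w) \<le> L2_set (\<lambda>i. cmod (vec_index v i) + cmod (vec_index w i)) {..<n}"
    unfolding hilbert_norm_eq using assms by (auto intro!: L2_set_mono norm_triangle_ineq4)
  also have "\<dots> \<le> hilbert_norm v + hilbert_norm w"
    using assms by (auto simp: hilbert_norm_eq intro: L2_set_triangle_ineq)
  finally show ?thesis .
qed

text \<open>In the triple sum for the inner product of \<open>W v\<close> with itself, summing over
  the row index first produces the entries of the Gram matrix of the columns of \<open>W\<close>,
  here the identity.\<close>

lemma hilbert_norm_isometry: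
  assumes W: "W \<in> carrier_mat n n" "mat_adjoint W * W = 1\<^sub>m n" and v: "v \<in> carrier_vec n"
  shows "hilbert_norm (W *\<^sub>v v) = hilbert_norm v"
proof -
  have *: "(\<Sum>i<n. cnj (W $$ (i, k)) * W $$ (i, l)) = (if k = l then 1 else 0)"
    if "k < n" "l < n" for k l
  proof -
    have "(mat_adjoint W * W) $$ (k, l) = (1\<^sub>m n :: complex mat) $$ (k, l)" using W(2) by simp
    moreover have "(mat_adjoint W * W) $$ (k, l) = (\<Sum>i<n. cnj (W $$ (i, k)) * W $$ (i, l))"
      using W(1) that by (subst mat_mult_index[of _ n n _ n]) auto
    ultimately show ?thesis using that by simp
  qed
  have "(W *\<^sub>v v) \<bullet>c (W *\<^sub>v v)
      = (\<Sum>i<n. (\<Sum>k<n. W $$ (i, k) * vec_index v k) * cnj (\<Sum>l<n. W $$ (i, l) * vec_index v l))"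
    using W v unfolding scalar_prod_def lessThan_atLeast0[symmetric]
    by (intro sum.cong) (auto simp: mat_vec_mult_index[of _ n n] simp del: index_mult_mat_vec)
  also have "\<dots> = (\<Sum>i<n. \<Sum>k<n. \<Sum>l<n. (cnj (W $$ (i, l)) * W $$ (i, k)) * (vec_index v k * cnj (vec_index v l)))"
    by (simp add: sum_product mult_ac)
  also have "\<dots> = (\<Sum>k<n. \<Sum>i<n. \<Sum>l<n. (cnj (W $$ (i, l)) * W $$ (i, k)) * (vec_index v k * cnj (vec_index v l)))"
    by (rule sum.swap)
  also have "\<dots> = (\<Sum>k<n. \<Sum>l<n. \<Sum>i<n. (cnj (W $$ (i, l)) * W $$ (i, k)) * (vec_index v k * cnj (vec_index v l)))"
    by (intro sum.cong refl sum.swap)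
  also have "\<dots> = (\<Sum>k<n. \<Sum>l<n. (if l = k then 1 else 0) * (vec_index v k * cnj (vec_index v l)))"
    by (intro sum.cong refl) (simp add: * flip: sum_distrib_right)
  also have "\<dots> = (\<Sum>k<n. vec_index v k * cnj (vec_index v k))"
    by (intro sum.cong refl) (simp add: if_distrib[of "\<lambda>x. x * _"] cong: if_cong)
  also have "\<dots> = v \<bullet>c v"
    using v by (auto simp: scalar_prod_def lessThan_atLeast0)
  finally show ?thesis by (simp add: hilbert_norm_def)
qed

section \<open>The operator norm as a supremum over unit vectors\<close>

abbreviation unit_sphere :: "nat \<Rightarrow> complex Matrix.vec set" where
  "unit_sphere n \<equiv> {v \<in> carrier_vec n. hilbert_norm v = 1}"

text \<open>A supremum over the empty set carries no information, hence the positive dimension; the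
  first basis vector is a witness.\<close>

lemma unit_sphere_nonempty:
  assumes "n > 0"
  shows "unit_sphere n \<noteq> {}"
proof -
  have "hilbert_norm (unit_vec n 0) = 1"
    using assms by (simp add: hilbert_norm_def scalar_prod_left_unit[of _ n])
  then show ?thesis using unit_vec_carrier[of n 0] by blast
qed

text \<open>Boundedness gives the real supremum in \<open>op_norm\<close> its meaning. Coordinates
  of a unit vector have modulus at most 1, so the sum of the moduli of all entries is a
  bound.\<close>

lemma op_norm_bdd_above:
  assumes A: "A \<in> carrier_mat m n"
  shows "bdd_above ((\<lambda>v. hilbert_norm (A *\<^sub>v v)) ` unit_sphere n)"
proof (rule bdd_aboveI2)
  fix v assume v: "v \<in> unit_sphere n"
  then have vc: "v \<in> carrier_vec n" by simp
  have le1: "cmod (vec_index v k) \<le> 1" if "k < n" for k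
    using member_le_L2_set[of "{..<n}" k "\<lambda>i. cmod (vec_index v i)"] v that
    by (auto simp: hilbert_norm_eq)
  have "hilbert_norm (A *\<^sub>v v) \<le> (\<Sum>i<m. cmod (vec_index (A *\<^sub>v v) i))"
    using A unfolding hilbert_norm_eq by (auto intro: L2_set_le_sum simp del: index_mult_mat_vec)
  also have "\<dots> \<le> (\<Sum>i<m. \<Sum>k<n. cmod (A $$ (i, k)))"
  proof (rule sum_mono)
    fix i assume "i \<in> {..<m}"
    then have "cmod (vec_index (A *\<^sub>v v) i) = cmod (\<Sum>k<n. A $$ (i, k) * vec_index v k)"
      using mat_vec_mult_index[OF A vc] by simp
    also have "\<dots> \<le> (\<Sum>k<n. cmod (A $$ (i, k)))"
      using le1 by (intro sum_norm_le) (auto simp: norm_mult intro: mult_left_le)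
    finally show "cmod (vec_index (A *\<^sub>v v) i) \<le> \<dots>" .
  qed
  finally show "hilbert_norm (A *\<^sub>v v) \<le> \<dots>" .
qed

lemma op_norm_upper:
  assumes "A \<in> carrier_mat m n" "v \<in> carrier_vec n" "hilbert_norm v = 1"
  shows "hilbert_norm (A *\<^sub>v v) \<le> op_norm A"
  using cSUP_upper[OF _ op_norm_bdd_above[OF assms(1)], of v] assms by (auto simp: op_norm_def)

lemma op_norm_least:
  assumes "A \<in> carrier_mat m n" "n > 0"
    and "\<And>v. v \<in> carrier_vec n \<Longrightarrow> hilbert_norm v = 1 \<Longrightarrow> hilbert_norm (A *\<^sub>v v) \<le> B"
  shows "op_norm A \<le> B"
  unfolding op_norm_def using assms unit_sphere_nonempty[of n]
  by (intro cSUP_least) auto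

lemma op_norm_nonneg:
  assumes "A \<in> carrier_mat m n" "n > 0"
  shows "0 \<le> op_norm A"
proof -
  obtain v where "v \<in> unit_sphere n" using unit_sphere_nonempty[OF assms(2)] by blast
  then show ?thesis
    using op_norm_upper[OF assms(1), of v] hilbert_norm_nonneg[of "A *\<^sub>v v"] by auto
qed

lemma op_norm_zero:
  assumes "n > 0"
  shows "op_norm (0\<^sub>m m n) = 0"
  by (intro antisym op_norm_least[of _ m n] op_norm_nonneg[of _ m n]) (use assms in \<open>auto simp: hilbert_norm_eq L2_set_def\<close>)

text \<open>The isometry \<open>W\<close> preserves norms and maps unit vectors to unit vectors, so
  each of the two products in the commutator has norm at most that of \<open>A\<close>.\<close>

lemma op_norm_commutator_isometry_le:
  assumes A: "A \<in> carrier_mat n n" and W: "W \<in> carrier_mat n n" "mat_adjoint W * W = 1\<^sub>m n"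
    and "n > 0"
  shows "op_norm (commutator W A) \<le> 2 * op_norm A"
proof (rule op_norm_least[OF _ \<open>n > 0\<close>])
  show "commutator W A \<in> carrier_mat n n"
    using A W by (auto simp: commutator_def intro!: minus_carrier_mat mult_carrier_mat)
  fix v :: "complex Matrix.vec" assume v: "v \<in> carrier_vec n" "hilbert_norm v = 1"
  have Wv: "W *\<^sub>v v \<in> carrier_vec n" "hilbert_norm (W *\<^sub>v v) = 1"
    using W v hilbert_norm_isometry[OF W] by auto
  have Av: "A *\<^sub>v v \<in> carrier_vec n" using A v by auto
  have "commutator W A *\<^sub>v v = W *\<^sub>v (A *\<^sub>v v) - A *\<^sub>v (W *\<^sub>v v)"
    unfolding commutator_def using A W v
    by (subst minus_mult_distrib_mat_vec[of _ n n]) auto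
  then have "hilbert_norm (commutator W A *\<^sub>v v) \<le> hilbert_norm (W *\<^sub>v (A *\<^sub>v v)) + hilbert_norm (A *\<^sub>v (W *\<^sub>v v))"
    using hilbert_norm_diff_le[of "W *\<^sub>v (A *\<^sub>v v)" n "A *\<^sub>v (W *\<^sub>v v)"] W A Av Wv(1)
    by (metis mult_mat_vec_carrier)
  also have "hilbert_norm (W *\<^sub>v (A *\<^sub>v v)) = hilbert_norm (A *\<^sub>v v)"
    using hilbert_norm_isometry[OF W Av] .
  finally show "hilbert_norm (commutator W A *\<^sub>v v) \<le> 2 * op_norm A"
    using op_norm_upper[OF A v] op_norm_upper[OF A Wv] by simp
qed

section \<open>The matrix exponential\<close>

text \<open>Powers are built by multiplication on the right, whereas the differential equation of
  the exponential needs the factor \<open>A\<close> on the left.\<close>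

lemma pow_mat_commute:
  assumes "A \<in> carrier_mat d d"
  shows "A * A ^\<^sub>m n = A ^\<^sub>m n * A"
proof (induction n)
  case (Suc n)
  have "A * (A ^\<^sub>m n * A) = (A * A ^\<^sub>m n) * A"
    using assms by (intro assoc_mult_mat[symmetric]) (auto intro: pow_carrier_mat)
  then show ?case using Suc by simp
qed (use assms in simp)

text \<open>The sum of the moduli of all entries dominates every column sum of \<open>A\<close>, so
  each multiplication by \<open>A\<close> costs one more such factor. Geometric growth is enough for
  the exponential series.\<close>

lemma pow_mat_index_bound:
  fixes A :: "complex mat"
  assumes A: "A \<in> carrier_mat d d" and ik: "i < d" "k < d"
  shows "cmod ((A ^\<^sub>m n) $$ (i, k)) \<le> (\<Sum>k<d. \<Sum>i<d. cmod (A $$ (i, k))) ^ n" (is "_ \<le> ?K ^ n")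
  using ik
proof (induction n arbitrary: k)
  case 0
  then show ?case using A by simp
next
  case (Suc n)
  have K: "?K \<ge> 0" by (intro sum_nonneg) auto
  have "cmod ((A ^\<^sub>m Suc n) $$ (i, k)) = cmod (\<Sum>l<d. (A ^\<^sub>m n) $$ (i, l) * A $$ (l, k))"
    unfolding pow_mat.simps
    by (subst mat_mult_index[OF pow_carrier_mat[OF A] A]) (use Suc.prems in auto)
  also have "\<dots> \<le> (\<Sum>l<d. ?K ^ n * cmod (A $$ (l, k)))"
    using Suc by (intro sum_norm_le) (auto simp: norm_mult intro: mult_right_mono)
  also have "\<dots> = ?K ^ n * (\<Sum>l<d. cmod (A $$ (l, k)))"
    by (simp add: sum_distrib_left)
  also have "\<dots> \<le> ?K ^ n * ?K"
    using Suc.prems K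
    by (intro mult_left_mono member_le_sum[of k "{..<d}" "\<lambda>k. \<Sum>i<d. cmod (A $$ (i, k))"]) (auto intro: sum_nonneg)
  finally show ?case by (simp add: mult.commute)
qed

text \<open>The coefficient of \<open>t ^ n\<close> in the entry \<open>(i, k)\<close> of
  \<open>exp (- \<i> t A)\<close>. Working entrywise brings everything down to scalar power
  series.\<close>

definition exp_coeff :: "complex mat \<Rightarrow> nat \<Rightarrow> nat \<Rightarrow> nat \<Rightarrow> complex" where
  "exp_coeff A i k n = (- \<i>) ^ n * (A ^\<^sub>m n) $$ (i, k) / fact n"

text \<open>This is \<open>exp (- \<i> t A)\<close>, the free evolution under the time-independent
  Hamiltonian \<open>A\<close>.\<close>

definition exp_flow :: "complex mat \<Rightarrow> real \<Rightarrow> complex mat" where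
  "exp_flow A t = mat (dim_row A) (dim_row A) (\<lambda>(i, k). \<Sum>n. exp_coeff A i k n * complex_of_real t ^ n)"

lemma exp_flow_carrier [simp]: "A \<in> carrier_mat d d \<Longrightarrow> exp_flow A t \<in> carrier_mat d d"
  by (simp add: exp_flow_def)

text \<open>Comparison with the real exponential series. The argument is complex because termwise
  differentiation is done in the complex plane before restricting to real times.\<close>

lemma exp_coeff_summable:
  assumes "A \<in> carrier_mat d d" "i < d" "k < d"
  shows "summable (\<lambda>n. exp_coeff A i k n * z ^ n)"
proof (rule summable_comparison_test')
  define K where "K = (\<Sum>k<d. \<Sum>i<d. cmod (A $$ (i, k)))"
  show "summable (\<lambda>n. inverse (fact n) * (K * cmod z) ^ n)" by (rule summable_exp)
  show "norm (exp_coeff A i k n * z ^ n) \<le> inverse (fact n) * (K * cmod z) ^ n" for n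
    using pow_mat_index_bound[OF assms, of n]
    by (auto simp: exp_coeff_def norm_mult norm_divide norm_power power_mult_distrib K_def field_simps
        intro!: mult_left_mono)
qed

lemma exp_flow_sums:
  assumes "A \<in> carrier_mat d d" "i < d" "k < d"
  shows "(\<lambda>n. exp_coeff A i k n * complex_of_real t ^ n) sums (exp_flow A t $$ (i, k))"
  using assms exp_coeff_summable[OF assms] by (simp add: exp_flow_def summable_sums)

text \<open>The coefficients of the formal derivative: the factor \<open>n + 1\<close> cancels
  against the factorial, and one factor \<open>- \<i> A\<close> is split off on the left.\<close>

lemma diffs_exp_coeff:
  assumes A: "A \<in> carrier_mat d d" and ik: "i < d" "k < d"
  shows "diffs (exp_coeff A i k) n = (\<Sum>l<d. - \<i> * A $$ (i, l) * exp_coeff A l k n)"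
proof -
  have "(A ^\<^sub>m Suc n) $$ (i, k) = (A * A ^\<^sub>m n) $$ (i, k)"
    using pow_mat_commute[OF A] by simp
  also have "\<dots> = (\<Sum>l<d. A $$ (i, l) * (A ^\<^sub>m n) $$ (l, k))"
    by (rule mat_mult_index[OF A pow_carrier_mat[OF A] ik])
  finally have *: "(A ^\<^sub>m Suc n) $$ (i, k) = (\<Sum>l<d. A $$ (i, l) * (A ^\<^sub>m n) $$ (l, k))" .
  have "diffs (exp_coeff A i k) n = of_nat (Suc n) * ((- \<i>) ^ Suc n * (A ^\<^sub>m Suc n) $$ (i, k) / fact (Suc n))"
    by (simp only: diffs_def exp_coeff_def)
  also have "\<dots> = (- \<i>) ^ Suc n * (A ^\<^sub>m Suc n) $$ (i, k) / fact n"
    unfolding fact_Suc by (simp del: pow_mat.simps of_nat_Suc)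
  also have "\<dots> = (\<Sum>l<d. - \<i> * A $$ (i, l) * exp_coeff A l k n)"
    unfolding * by (simp add: exp_coeff_def sum_distrib_left sum_divide_distrib sum_negf mult_ac)
  finally show ?thesis .
qed

lemma exp_flow_derivative:
  assumes A: "A \<in> carrier_mat d d" and ik: "i < d" "k < d"
  shows "((\<lambda>s. exp_flow A s $$ (i, k)) has_vector_derivative - \<i> * (A * exp_flow A t) $$ (i, k)) (at t)"
proof -
  have "((\<lambda>z. \<Sum>n. exp_coeff A i k n * z ^ n) has_field_derivative
      (\<Sum>n. diffs (exp_coeff A i k) n * complex_of_real t ^ n)) (at (complex_of_real t))"
    by (rule termdiffs_strong_converges_everywhere[OF exp_coeff_summable[OF assms]])
  then have "((\<lambda>s. \<Sum>n. exp_coeff A i k n * complex_of_real s ^ n) has_vector_derivative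
      (\<Sum>n. diffs (exp_coeff A i k) n * complex_of_real t ^ n)) (at t)"
    by (rule has_vector_derivative_real_field)
  moreover have "(\<Sum>n. diffs (exp_coeff A i k) n * complex_of_real t ^ n) = - \<i> * (A * exp_flow A t) $$ (i, k)"
  proof (rule sums_unique[symmetric])
    have "(\<lambda>n. \<Sum>l<d. - \<i> * A $$ (i, l) * (exp_coeff A l k n * complex_of_real t ^ n)) sums
        (\<Sum>l<d. - \<i> * A $$ (i, l) * exp_flow A t $$ (l, k))"
      using A ik by (intro sums_sum sums_mult exp_flow_sums) auto
    also have "(\<Sum>l<d. - \<i> * A $$ (i, l) * exp_flow A t $$ (l, k)) = - \<i> * (A * exp_flow A t) $$ (i, k)"
      unfolding mat_mult_index[OF A exp_flow_carrier[OF A] ik] sum_distrib_left by (simp add: mult.assoc)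
    finally show "(\<lambda>n. diffs (exp_coeff A i k) n * complex_of_real t ^ n) sums \<dots>"
      by (simp add: diffs_exp_coeff[OF assms] sum_distrib_right mult.assoc)
  qed
  moreover have "exp_flow A s $$ (i, k) = (\<Sum>n. exp_coeff A i k n * complex_of_real s ^ n)" for s
    using A ik by (simp add: exp_flow_def)
  ultimately show ?thesis by simp
qed

lemma exp_flow_0:
  assumes A: "A \<in> carrier_mat d d"
  shows "exp_flow A 0 = 1\<^sub>m d"
proof (rule eq_matI)
  fix i k assume "i < dim_row (1\<^sub>m d :: complex mat)" "k < dim_col (1\<^sub>m d :: complex mat)"
  then show "exp_flow A 0 $$ (i, k) = (1\<^sub>m d :: complex mat) $$ (i, k)"
    using A powser_zero[of "exp_coeff A i k"]
    by (simp add: exp_flow_def) (simp add: exp_coeff_def)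
qed (use A in \<open>auto simp: exp_flow_def\<close>)

text \<open>Both products have entrywise power series with equal terms, as \<open>A\<close> commutes
  with its powers. This is why free evolution adds nothing to the cost.\<close>

lemma exp_flow_commute:
  assumes A: "A \<in> carrier_mat d d"
  shows "exp_flow A t * A = A * exp_flow A t"
proof (rule eq_matI)
  fix i k assume "i < dim_row (A * exp_flow A t)" "k < dim_col (A * exp_flow A t)"
  then have ik: "i < d" "k < d" using A by (auto simp: exp_flow_def)
  let ?S = "\<lambda>B. (\<lambda>n. (- \<i>) ^ n * B n $$ (i, k) / fact n * complex_of_real t ^ n)"
  have l: "?S (\<lambda>n. A * A ^\<^sub>m n) sums ((A * exp_flow A t) $$ (i, k))"
  proof -
    have "(\<lambda>n. \<Sum>l<d. A $$ (i, l) * (exp_coeff A l k n * complex_of_real t ^ n)) sums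
        (\<Sum>l<d. A $$ (i, l) * exp_flow A t $$ (l, k))"
      using A ik by (intro sums_sum sums_mult exp_flow_sums) auto
    then show ?thesis
      unfolding mat_mult_index[OF A exp_flow_carrier[OF A] ik] mat_mult_index[OF A pow_carrier_mat[OF A] ik]
      by (simp add: exp_coeff_def sum_distrib_left sum_distrib_right sum_divide_distrib mult_ac)
  qed
  have r: "?S (\<lambda>n. A ^\<^sub>m n * A) sums ((exp_flow A t * A) $$ (i, k))"
  proof -
    have "(\<lambda>n. \<Sum>l<d. (exp_coeff A i l n * complex_of_real t ^ n) * A $$ (l, k)) sums
        (\<Sum>l<d. exp_flow A t $$ (i, l) * A $$ (l, k))"
      using A ik by (intro sums_sum sums_mult2 exp_flow_sums) auto
    then show ?thesis
      unfolding mat_mult_index[OF exp_flow_carrier[OF A] A ik] mat_mult_index[OF pow_carrier_mat[OF A] A ik]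
      by (simp add: exp_coeff_def sum_distrib_left sum_distrib_right sum_divide_distrib mult_ac)
  qed
  show "(exp_flow A t * A) $$ (i, k) = (A * exp_flow A t) $$ (i, k)"
    using l r unfolding pow_mat_commute[OF A] by (rule sums_unique2[symmetric])
qed (use A in \<open>auto simp: exp_flow_def\<close>)

section \<open>Propagators\<close>

text \<open>The derivative is continuous, hence bounded on the compact interval, and the mean value
  inequality gives a Lipschitz constant.\<close>

lemma exp_flow_abs_cont:
  assumes A: "A \<in> carrier_mat d d" and ik: "i < d" "k < d"
  shows "abs_cont_on a b (\<lambda>t. exp_flow A t $$ (i, k))"
proof -
  have cont: "continuous_on {a..b} (\<lambda>t. exp_flow A t $$ (l, k))" if "l < d" for l
    using exp_flow_derivative[OF A that ik(2)]
    by (intro continuous_at_imp_continuous_on ballI) (blast dest: has_vector_derivative_continuous)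
  have "continuous_on {a..b} (\<lambda>t. - \<i> * (\<Sum>l<d. A $$ (i, l) * exp_flow A t $$ (l, k)))"
    by (intro continuous_intros cont) auto
  then have "bounded ((\<lambda>t. - \<i> * (\<Sum>l<d. A $$ (i, l) * exp_flow A t $$ (l, k))) ` {a..b})"
    by (intro compact_imp_bounded compact_continuous_image) auto
  then obtain K where K: "\<And>t. t \<in> {a..b} \<Longrightarrow> norm (- \<i> * (\<Sum>l<d. A $$ (i, l) * exp_flow A t $$ (l, k))) \<le> K"
    unfolding bounded_iff by blast
  show ?thesis
  proof (rule abs_cont_on_lipschitz)
    fix x y assume xy: "x \<in> {a..b}" "y \<in> {a..b}"
    have "norm (exp_flow A x $$ (i, k) - exp_flow A y $$ (i, k)) \<le> K * norm (x - y)"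
    proof (rule differentiable_bound[OF _ _ _ xy])
      fix t assume t: "t \<in> {a..b}"
      show "((\<lambda>t. exp_flow A t $$ (i, k)) has_derivative (\<lambda>s. s *\<^sub>R (- \<i> * (A * exp_flow A t) $$ (i, k)))) (at t within {a..b})"
        using exp_flow_derivative[OF A ik, of t]
        by (auto simp: has_vector_derivative_def intro: has_derivative_at_withinI)
      show "onorm (\<lambda>s. s *\<^sub>R (- \<i> * (A * exp_flow A t) $$ (i, k))) \<le> K"
      proof (rule onorm_le)
        show "norm (s *\<^sub>R (- \<i> * (A * exp_flow A t) $$ (i, k))) \<le> K * norm s" for s
          using mult_right_mono[OF K[OF t], of "\<bar>s\<bar>"]
          unfolding mat_mult_index[OF A exp_flow_carrier[OF A] ik] norm_scaleR by (simp add: mult.commute)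
      qed
    qed auto
    then show "dist (exp_flow A x $$ (i, k)) (exp_flow A y $$ (i, k)) \<le> K * \<bar>x - y\<bar>"
      by (simp add: dist_norm)
  qed
qed

lemma self_adjoint_op_index:
  assumes "self_adjoint_op n A" "i < 2 ^ n" "k < 2 ^ n"
  shows "cnj (A $$ (k, i)) = A $$ (i, k)"
  using assms mat_adjoint_index[of i A k] by (auto simp: self_adjoint_op_def)

lemma hamiltonian_index:
  assumes "i < 2 ^ n" "k < 2 ^ n"
  shows "hamiltonian n m H u t $$ (i, k) = H 0 $$ (i, k) + (\<Sum>j = 1..m. complex_of_real (u j t) * H j $$ (i, k))"
  using assms by (simp add: hamiltonian_def)

lemma hamiltonian_carrier [simp]: "hamiltonian n m H u t \<in> carrier_mat (2 ^ n) (2 ^ n)"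
  by (auto simp: hamiltonian_def)

text \<open>The control values are real, so conjugation passes to the self-adjoint
  operators.\<close>

lemma hamiltonian_hermitian:
  assumes "\<And>j. j \<in> {0..m} \<Longrightarrow> self_adjoint_op n (H j)" "i < 2 ^ n" "k < 2 ^ n"
  shows "cnj (hamiltonian n m H u t $$ (k, i)) = hamiltonian n m H u t $$ (i, k)"
  using self_adjoint_op_index[OF assms(1,2,3)] assms(2,3) by (simp add: hamiltonian_index)

section \<open>Restriction to a shorter time horizon\<close>

lemma AE_lebesgue_on_subset:
  assumes "AE t in lebesgue_on B. P t" "A \<subseteq> B" "A \<in> sets lebesgue" "B \<in> sets lebesgue"
  shows "AE t in lebesgue_on A. P t"
  using assms by (auto simp: AE_restrict_space_iff elim!: eventually_mono)

lemma has_mat_derivative_subset: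
  assumes "has_mat_derivative U D (at t within B)" "A \<subseteq> B"
  shows "has_mat_derivative U D (at t within A)"
  using assms has_vector_derivative_within_subset unfolding has_mat_derivative_def by blast

text \<open>Serves twice: to cut a control off at a time \<open>T\<close> before
  \<open>\<Gamma>\<close> is reached, and to carry the isometry property from the final time to all
  intermediate times.\<close>

lemma propagator_restrict:
  assumes "propagator n m H u T U" "0 \<le> s" "s \<le> T"
  shows "propagator n m H u s U"
proof -
  have "AE t in lebesgue_on {0..T}. \<exists>D \<in> carrier_mat (2 ^ n) (2 ^ n).
          has_mat_derivative U D (at t within {0..s}) \<and> \<i> \<cdot>\<^sub>m D = hamiltonian n m H u t * U t"
    using assms(1) has_mat_derivative_subset[of U _ _ "{0..T}" "{0..s}"] assms(3)
    unfolding propagator_def by (auto elim!: eventually_mono)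
  then have "AE t in lebesgue_on {0..s}. \<exists>D \<in> carrier_mat (2 ^ n) (2 ^ n).
          has_mat_derivative U D (at t within {0..s}) \<and> \<i> \<cdot>\<^sub>m D = hamiltonian n m H u t * U t"
    by (rule AE_lebesgue_on_subset) (use assms(3) in auto)
  then show ?thesis
    using assms unfolding propagator_def by (auto intro: abs_cont_on_subinterval)
qed

lemma admissible_controls_restrict:
  assumes "u \<in> admissible_controls M m T" "s \<le> T"
  shows "u \<in> admissible_controls M m s"
  unfolding admissible_controls_def
proof (intro CollectI ballI conjI)
  fix j assume "j \<in> {1..m}"
  then have u: "u j \<in> borel_measurable (lebesgue_on {0..T})" "AE t in lebesgue_on {0..T}. \<bar>u j t\<bar> \<le> M"
    using assms by (auto simp: admissible_controls_def)
  show "u j \<in> borel_measurable (lebesgue_on {0..s})"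
    by (rule measurable_restrict_mono[OF u(1)]) (use assms in auto)
  show "AE t in lebesgue_on {0..s}. \<bar>u j t\<bar> \<le> M"
    by (rule AE_lebesgue_on_subset[OF u(2)]) (use assms in auto)
qed

text \<open>With \<open>h\<close> the Hermitian generator, the derivative of the Gram matrix of
  \<open>U\<close> consists of \<open>- \<i>\<close> and \<open>+ \<i>\<close> times the same
  matrix, so it vanishes almost everywhere.\<close>

lemma propagator_isometry:
  assumes H: "\<And>j. j \<in> {0..m} \<Longrightarrow> self_adjoint_op n (H j)"
    and U: "propagator n m H u T U" and "0 \<le> T"
  shows "mat_adjoint (U T) * U T = 1\<^sub>m (2 ^ n)"
proof -
  define d where "d = (2::nat) ^ n"
  define h where "h t = hamiltonian n m H u t" for t
  have hc: "h t \<in> carrier_mat d d" for t by (simp add: h_def d_def)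
  have UC: "U t \<in> carrier_mat d d" if "t \<in> {0..T}" for t
    using U that by (simp add: propagator_def d_def)
  have gram: "(mat_adjoint (U t) * U t) $$ (i, k) = (\<Sum>l<d. cnj (U t $$ (l, i)) * U t $$ (l, k))"
    if "t \<in> {0..T}" "i < d" "k < d" for t i k
    using UC[OF that(1)] that(2,3) by (subst mat_mult_index[of _ d d _ d]) auto
  show ?thesis
  proof (rule eq_matI)
    fix i k assume "i < dim_row (1\<^sub>m (2 ^ n) :: complex mat)" "k < dim_col (1\<^sub>m (2 ^ n) :: complex mat)"
    then have ik: "i < d" "k < d" by (auto simp: d_def)
    define g where "g = (\<lambda>t. \<Sum>l<d. cnj (U t $$ (l, i)) * U t $$ (l, k))"
    have "g T = g 0"
    proof (rule abs_cont_on_derivative_zero[OF _ \<open>0 \<le> T\<close>])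
      show "abs_cont_on 0 T g"
        unfolding g_def using U ik
        by (intro abs_cont_on_sum abs_cont_on_mult abs_cont_on_cnj) (auto simp: propagator_def d_def)
      have *: "(g has_vector_derivative 0) (at t within {0..T})"
        if t: "t \<in> {0..T}" and D: "D \<in> carrier_mat d d" "has_mat_derivative U D (at t within {0..T})"
          and eq: "\<i> \<cdot>\<^sub>m D = h t * U t" for t D
      proof -
        have De: "D $$ (p, q) = - \<i> * (\<Sum>r<d. h t $$ (p, r) * U t $$ (r, q))" if "p < d" "q < d" for p q
        proof -
          have "(\<i> \<cdot>\<^sub>m D) $$ (p, q) = (\<Sum>r<d. h t $$ (p, r) * U t $$ (r, q))"
            unfolding eq using mat_mult_index[OF hc UC[OF t] that] .
          moreover have "D $$ (p, q) = - \<i> * (\<i> \<cdot>\<^sub>m D) $$ (p, q)"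
            using D(1) that by (simp flip: mult.assoc)
          ultimately show ?thesis by simp
        qed
        have "((\<lambda>s. \<Sum>l<d. cnj (U s $$ (l, i)) * U s $$ (l, k)) has_vector_derivative
            (\<Sum>l<d. cnj (U t $$ (l, i)) * D $$ (l, k) + cnj (D $$ (l, i)) * U t $$ (l, k))) (at t within {0..T})"
          using D ik
          by (intro has_vector_derivative_sum has_vector_derivative_mult has_vector_derivative_cnj)
            (auto simp: has_mat_derivative_def)
        moreover have "(\<Sum>l<d. cnj (U t $$ (l, i)) * D $$ (l, k) + cnj (D $$ (l, i)) * U t $$ (l, k)) = 0"
        proof -
          \<comment> \<open>Exchanging the sums and using that \<open>h t\<close> is Hermitian turns
            this half of the product rule into the negative of the other half.\<close>
          have "(\<Sum>l<d. cnj (D $$ (l, i)) * U t $$ (l, k))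
              = (\<Sum>l<d. \<Sum>r<d. \<i> * cnj (h t $$ (l, r)) * cnj (U t $$ (r, i)) * U t $$ (l, k))"
            using ik by (intro sum.cong refl) (simp add: De sum_distrib_left sum_distrib_right mult_ac)
          also have "\<dots> = (\<Sum>r<d. \<Sum>l<d. \<i> * cnj (h t $$ (l, r)) * cnj (U t $$ (r, i)) * U t $$ (l, k))"
            by (rule sum.swap)
          also have "\<dots> = (\<Sum>r<d. \<Sum>l<d. \<i> * h t $$ (r, l) * cnj (U t $$ (r, i)) * U t $$ (l, k))"
            using hamiltonian_hermitian[of m n H, OF H] by (intro sum.cong refl) (simp add: h_def d_def)
          also have "\<dots> = - (\<Sum>l<d. cnj (U t $$ (l, i)) * D $$ (l, k))"
            unfolding sum_negf[symmetric]
            using ik by (intro sum.cong refl) (simp add: De sum_distrib_left sum_negf mult_ac)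
          finally show ?thesis by (simp add: sum.distrib)
        qed
        ultimately show ?thesis by (simp add: g_def)
      qed
      have "AE t in lebesgue_on {0..T}. \<exists>D \<in> carrier_mat d d.
          has_mat_derivative U D (at t within {0..T}) \<and> \<i> \<cdot>\<^sub>m D = h t * U t"
        using U by (simp add: propagator_def h_def d_def)
      moreover have "AE t in lebesgue_on {0..T}. t \<in> {0..T}"
        by (rule AE_I2) auto
      ultimately show "AE t in lebesgue_on {0..T}. (g has_vector_derivative 0) (at t within {0..T})"
        by eventually_elim (use * in blast)
    qed
    moreover have "g 0 = (1\<^sub>m d :: complex mat) $$ (i, k)"
    proof -
      have U0: "U 0 = 1\<^sub>m d" using U by (simp add: propagator_def d_def)
      show ?thesis
        unfolding g_def U0 using ik by (simp add: if_distrib[of cnj] if_distrib[of "\<lambda>x. x * _"] cong: if_cong)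
    qed
    ultimately show "(mat_adjoint (U T) * U T) $$ (i, k) = (1\<^sub>m (2 ^ n) :: complex mat) $$ (i, k)"
      using gram[of T i k] ik \<open>0 \<le> T\<close> by (simp add: g_def d_def)
  qed (use UC[of T] \<open>0 \<le> T\<close> in \<open>auto simp: d_def\<close>)
qed

section \<open>Continuation with the controls switched off\<close>

lemma admissible_controls_extend:
  assumes u: "u \<in> admissible_controls M m c" and "c \<le> T" "0 \<le> M"
  shows "(\<lambda>j t. if t \<le> c then u j t else 0) \<in> admissible_controls M m T"
  unfolding admissible_controls_def
proof (intro CollectI ballI conjI)
  fix j assume j: "j \<in> {1..m}"
  \<comment> \<open>Extension by zero off the measurable set \<open>{0..c}\<close> is measurable on
    the whole line; on \<open>{0..T}\<close> its condition agrees with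
    \<open>t \<le> c\<close>.\<close>
  have "(\<lambda>t. if t \<in> {0..c} then u j t else 0) \<in> borel_measurable lebesgue"
    using u j by (intro borel_measurable_if_I) (auto simp: admissible_controls_def)
  then have "(\<lambda>t. if t \<in> {0..c} then u j t else 0) \<in> borel_measurable (lebesgue_on {0..T})"
    by (rule measurable_restrict_space1)
  then show "(\<lambda>t. if t \<le> c then u j t else 0) \<in> borel_measurable (lebesgue_on {0..T})"
    by (rule measurable_cong[THEN iffD1, rotated]) auto
  have "AE t in lebesgue. t \<in> {0..c} \<longrightarrow> \<bar>u j t\<bar> \<le> M"
    using u j by (auto simp: admissible_controls_def AE_restrict_space_iff)
  then show "AE t in lebesgue_on {0..T}. \<bar>if t \<le> c then u j t else 0\<bar> \<le> M"
    using \<open>0 \<le> M\<close> by (auto simp: AE_restrict_space_iff elim!: eventually_mono)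
qed

text \<open>With zero controls only the drift remains, so the solution continues from
  \<open>U c\<close> by \<open>exp (- \<i> (t - c) H\<^sub>0)\<close>. The pieces agree at
  \<open>c\<close> because the exponential at 0 is the identity.\<close>

lemma propagator_extend:
  assumes U: "propagator n m H u c U" and c: "0 < c" "c \<le> T"
    and H0: "H 0 \<in> carrier_mat (2 ^ n) (2 ^ n)"
  shows "propagator n m H (\<lambda>j t. if t \<le> c then u j t else 0) T
    (\<lambda>t. if t \<le> c then U t else exp_flow (H 0) (t - c) * U c)"
    (is "propagator n m H ?u T ?U")
proof -
  define d where "d = (2::nat) ^ n"
  define V where "V t = exp_flow (H 0) (t - c) * U c" for t
  have A: "H 0 \<in> carrier_mat d d" using H0 by (simp add: d_def)
  have Uc: "U c \<in> carrier_mat d d" using U c by (simp add: propagator_def d_def)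
  have VC: "V t \<in> carrier_mat d d" for t
    unfolding V_def using A Uc by (metis exp_flow_carrier mult_carrier_mat)
  have Vi: "V t $$ (i, k) = (\<Sum>l<d. exp_flow (H 0) (t - c) $$ (i, l) * U c $$ (l, k))" if "i < d" "k < d" for t i k
    unfolding V_def by (rule mat_mult_index[OF exp_flow_carrier[OF A] Uc that])
  have Vc: "V c = U c" using Uc by (simp add: V_def exp_flow_0[OF A])
  have Ueq: "?U t = (if t \<le> c then U t else V t)" for t by (simp add: V_def)
  have Vac: "abs_cont_on c T (\<lambda>t. V t $$ (i, k))" if "i < d" "k < d" for i k
    unfolding Vi[OF that]
  proof (intro abs_cont_on_sum abs_cont_on_mult abs_cont_on_const)
    fix l assume "l \<in> {..<d}"
    then show "abs_cont_on c T (\<lambda>t. exp_flow (H 0) (t - c) $$ (i, l))"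
      by (intro abs_cont_on_compose_mono[OF exp_flow_abs_cont[OF A \<open>i < d\<close>, of l 0 "T - c"]])
        (auto intro!: mono_onI)
  qed
  have ac: "abs_cont_on 0 T (\<lambda>t. ?U t $$ (i, k))" if "i < d" "k < d" for i k
  proof -
    have "abs_cont_on 0 T (\<lambda>t. if t \<le> c then U t $$ (i, k) else V t $$ (i, k))"
      using U c Vac[OF that] Vc that by (intro abs_cont_on_join) (auto simp: propagator_def d_def)
    then show ?thesis by (rule abs_cont_on_cong) (simp add: V_def)
  qed
  \<comment> \<open>At an interior point the one-interval derivative is the two-sided derivative,
    which depends only on values near \<open>t\<close> and so passes to the joined function.\<close>
  have before: "\<exists>D \<in> carrier_mat d d. has_mat_derivative ?U D (at t within {0..T}) \<and> \<i> \<cdot>\<^sub>m D = hamiltonian n m H ?u t * ?U t"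
    if t: "0 < t" "t < c" and ex: "\<exists>D \<in> carrier_mat d d. has_mat_derivative U D (at t within {0..c}) \<and> \<i> \<cdot>\<^sub>m D = hamiltonian n m H u t * U t" for t
  proof -
    obtain D where D: "D \<in> carrier_mat d d" "has_mat_derivative U D (at t within {0..c})" "\<i> \<cdot>\<^sub>m D = hamiltonian n m H u t * U t"
      using ex by blast
    have "has_mat_derivative ?U D (at t within {0..T})"
      unfolding has_mat_derivative_def
    proof (intro allI impI)
      fix i k assume ik: "i < dim_row D" "k < dim_col D"
      then have "((\<lambda>s. U s $$ (i, k)) has_vector_derivative D $$ (i, k)) (at t within {0..c})"
        using D(2) by (simp add: has_mat_derivative_def)
      then have "((\<lambda>s. U s $$ (i, k)) has_vector_derivative D $$ (i, k)) (at t)"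
        by (simp only: at_within_Icc_at[OF t])
      then have "((\<lambda>s. ?U s $$ (i, k)) has_vector_derivative D $$ (i, k)) (at t)"
        by (rule has_vector_derivative_transform_within_open[of _ _ _ "{..<c}"]) (use t in auto)
      then show "((\<lambda>s. ?U s $$ (i, k)) has_vector_derivative D $$ (i, k)) (at t within {0..T})"
        by (rule has_vector_derivative_at_within)
    qed
    moreover have "hamiltonian n m H ?u t = hamiltonian n m H u t"
      using t by (simp add: hamiltonian_def)
    ultimately show ?thesis using D t by (intro bexI[of _ D]) auto
  qed
  have after: "\<exists>D \<in> carrier_mat d d. has_mat_derivative ?U D (at t within {0..T}) \<and> \<i> \<cdot>\<^sub>m D = hamiltonian n m H ?u t * ?U t"
    if t: "c < t" for t
  proof (intro bexI conjI)
    let ?E = "exp_flow (H 0) (t - c)"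
    let ?D = "(- \<i>) \<cdot>\<^sub>m (H 0 * V t)"
    have HV: "H 0 * V t \<in> carrier_mat d d" using A VC by (metis mult_carrier_mat)
    then show "?D \<in> carrier_mat d d" by simp
    show "has_mat_derivative ?U ?D (at t within {0..T})"
      unfolding has_mat_derivative_def
    proof (intro allI impI)
      fix i k assume "i < dim_row ?D" "k < dim_col ?D"
      then have ik: "i < d" "k < d" using HV by auto
      have "((\<lambda>s. exp_flow (H 0) (s - c) $$ (i, l)) has_vector_derivative - \<i> * (H 0 * ?E) $$ (i, l)) (at t)"
        if "l < d" for l
      proof -
        have "((\<lambda>s. s - c) has_vector_derivative 1) (at t)"
          by (auto intro!: derivative_eq_intros)
        from vector_diff_chain_at[OF this exp_flow_derivative[OF A ik(1) that]] show ?thesis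
          by (simp add: o_def)
      qed
      then have "((\<lambda>s. V s $$ (i, k)) has_vector_derivative (\<Sum>l<d. - \<i> * (H 0 * ?E) $$ (i, l) * U c $$ (l, k))) (at t)"
        unfolding Vi[OF ik] by (intro has_vector_derivative_sum has_vector_derivative_mult_left) auto
      also have "(\<Sum>l<d. - \<i> * (H 0 * ?E) $$ (i, l) * U c $$ (l, k)) = - \<i> * ((H 0 * ?E) * U c) $$ (i, k)"
        unfolding mat_mult_index[OF mult_carrier_mat[OF A exp_flow_carrier[OF A]] Uc ik]
        by (simp only: sum_distrib_left mult.assoc)
      also have "(H 0 * ?E) * U c = H 0 * V t"
        unfolding V_def by (rule assoc_mult_mat[OF A exp_flow_carrier[OF A] Uc])
      also have "- \<i> * (H 0 * V t) $$ (i, k) = ?D $$ (i, k)"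
        using ik by (subst index_smult_mat(1)) (simp_all only: carrier_matD[OF HV])
      finally have "((\<lambda>s. V s $$ (i, k)) has_vector_derivative ?D $$ (i, k)) (at t)" .
      then have "((\<lambda>s. ?U s $$ (i, k)) has_vector_derivative ?D $$ (i, k)) (at t)"
        by (rule has_vector_derivative_transform_within_open[of _ _ _ "{c<..}"]) (use t in \<open>auto simp: V_def\<close>)
      then show "((\<lambda>s. ?U s $$ (i, k)) has_vector_derivative ?D $$ (i, k)) (at t within {0..T})"
        by (rule has_vector_derivative_at_within)
    qed
    have "hamiltonian n m H ?u t = H 0"
      using A t by (intro eq_matI) (auto simp: hamiltonian_def d_def)
    moreover have "\<i> \<cdot>\<^sub>m ?D = H 0 * V t"
      using HV by (intro eq_matI) auto
    ultimately show "\<i> \<cdot>\<^sub>m ?D = hamiltonian n m H ?u t * ?U t"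
      using t by (simp add: V_def)
  qed
  have "AE t in lebesgue. t \<in> {0..c} \<longrightarrow> (\<exists>D \<in> carrier_mat d d.
      has_mat_derivative U D (at t within {0..c}) \<and> \<i> \<cdot>\<^sub>m D = hamiltonian n m H u t * U t)"
    using U by (simp add: propagator_def d_def AE_restrict_space_iff)
  \<comment> \<open>The left end and the switching time are null sets; away from them all
    derivatives can be taken two-sided.\<close>
  moreover have "AE t in lebesgue. t \<noteq> 0" "AE t in lebesgue. t \<noteq> c"
    by (auto intro!: AE_completion AE_lborel_singleton)
  ultimately have "AE t in lebesgue. t \<in> {0..T} \<longrightarrow> (\<exists>D \<in> carrier_mat d d.
      has_mat_derivative ?U D (at t within {0..T}) \<and> \<i> \<cdot>\<^sub>m D = hamiltonian n m H ?u t * ?U t)"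
  proof eventually_elim
    case (elim t)
    show ?case
    proof
      assume "t \<in> {0..T}"
      show "\<exists>D \<in> carrier_mat d d. has_mat_derivative ?U D (at t within {0..T}) \<and> \<i> \<cdot>\<^sub>m D = hamiltonian n m H ?u t * ?U t"
      proof (cases "t < c")
        case True
        then show ?thesis using elim \<open>t \<in> {0..T}\<close> by (intro before) auto
      next
        case False
        then show ?thesis using elim by (intro after) auto
      qed
    qed
  qed
  then have "AE t in lebesgue_on {0..T}. \<exists>D \<in> carrier_mat d d.
      has_mat_derivative ?U D (at t within {0..T}) \<and> \<i> \<cdot>\<^sub>m D = hamiltonian n m H ?u t * ?U t"
    by (simp add: AE_restrict_space_iff)
  moreover have "?U t \<in> carrier_mat d d" if "t \<in> {0..T}" for t
    using U VC[of t] that by (auto simp: propagator_def d_def V_def)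
  moreover have "?U 0 = 1\<^sub>m d" using U c by (simp add: propagator_def d_def)
  ultimately show ?thesis
    using ac unfolding propagator_def d_def by blast
qed

section \<open>The value function\<close>

text \<open>No integrability of \<open>f\<close> is required, because the integral of a non-integrable function is \<open>0\<close>.\<close>

lemma integral_lebesgue_on_le:
  fixes f :: "real \<Rightarrow> real"
  assumes "\<And>t. t \<in> {0..T} \<Longrightarrow> f t \<le> (if t \<le> s then B else 0)" "0 \<le> B" "0 \<le> s" "s \<le> T"
  shows "(\<integral>t. f t \<partial>lebesgue_on {0..T}) \<le> B * s"
proof -
  have "integrable (lebesgue_on {0..T}) (\<lambda>t. B * indicat_real {0..s} t)"
    using assms(3,4) by (intro integrable_mult_right integrable_real_indicator)
      (auto simp: sets_restrict_space emeasure_restrict_space intro!: image_eqI[of _ _ "{0..s}"])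
  then have "(\<integral>t. f t \<partial>lebesgue_on {0..T}) \<le> (\<integral>t. B * indicat_real {0..s} t \<partial>lebesgue_on {0..T})"
  proof (rule integral_mono')
    fix t assume "t \<in> space (lebesgue_on {0..T})"
    then have "t \<in> {0..T}" by simp
    then show "f t \<le> B * indicat_real {0..s} t"
      using assms(1)[of t] by (auto simp: indicator_def split: if_splits)
  qed (use assms(2) in auto)
  also have "\<dots> = B * s"
    using assms(3,4) by (simp add: measure_restrict_space)
  finally show ?thesis .
qed

text \<open>A real infimum bounds from below only a set that is bounded below; the costs are
  nonnegative as integrals of squares.\<close>

lemma value_function_le:
  assumes "u \<in> admissible_controls M m T" "propagator n m H u T U"
  shows "value_function n M m H T \<Gamma>
    \<le> 1 / 2 * (\<integral>t. (op_norm (commutator (U t * mat_adjoint \<Gamma>) (H 0)))\<^sup>2 \<partial>lebesgue_on {0..T})"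
  unfolding value_function_def
proof (rule cInf_lower)
  show "bdd_below {1 / 2 * (\<integral>t. (op_norm (commutator (U t * mat_adjoint \<Gamma>) (H 0)))\<^sup>2 \<partial>lebesgue_on {0..T})
      | u U. u \<in> admissible_controls M m T \<and> propagator n m H u T U}"
    by (rule bdd_belowI[of _ 0]) (auto simp del: times_divide_eq_left)
qed (use assms in blast)

text \<open>The integrand is at most the square of \<open>2 * op_norm (H 0)\<close> up to time
  \<open>s\<close> and zero afterwards; the factor 1/2 in the cost leaves the constant 2.\<close>

lemma value_function_le_if_commute_after:
  assumes H: "\<And>j. j \<in> {0..m} \<Longrightarrow> self_adjoint_op n (H j)" and \<Gamma>: "unitary_op n \<Gamma>"
    and u: "u \<in> admissible_controls M m T" and U: "propagator n m H u T U"
    and s: "0 \<le> s" "s \<le> T"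
    and after: "\<And>t. s < t \<Longrightarrow> t \<le> T \<Longrightarrow> op_norm (commutator (U t * mat_adjoint \<Gamma>) (H 0)) = 0"
  shows "value_function n M m H T \<Gamma> \<le> 2 * (op_norm (H 0))\<^sup>2 * s"
proof -
  have H0: "H 0 \<in> carrier_mat (2 ^ n) (2 ^ n)"
    using H[of 0] by (simp add: self_adjoint_op_def)
  have \<Gamma>C: "\<Gamma> \<in> carrier_mat (2 ^ n) (2 ^ n)" "\<Gamma> * mat_adjoint \<Gamma> = 1\<^sub>m (2 ^ n)"
    using \<Gamma> by (auto simp: unitary_op_def)
  have "(op_norm (commutator (U t * mat_adjoint \<Gamma>) (H 0)))\<^sup>2 \<le> (if t \<le> s then (2 * op_norm (H 0))\<^sup>2 else 0)"
    if t: "t \<in> {0..T}" for t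
  proof (cases "t \<le> s")
    case True
    have UC: "U t \<in> carrier_mat (2 ^ n) (2 ^ n)" using U t by (simp add: propagator_def)
    have UU: "mat_adjoint (U t) * U t = 1\<^sub>m (2 ^ n)"
      using propagator_restrict[OF U, of t] t by (intro propagator_isometry[OF H]) auto
    define W where "W = U t * mat_adjoint \<Gamma>"
    have W: "W \<in> carrier_mat (2 ^ n) (2 ^ n)"
      unfolding W_def by (rule mult_carrier_mat[OF UC mat_adjoint_carrier[OF \<Gamma>C(1)]])
    have "mat_adjoint W = \<Gamma> * mat_adjoint (U t)"
      unfolding W_def by (simp add: mat_adjoint_mult[OF UC mat_adjoint_carrier[OF \<Gamma>C(1)]])
    then have "mat_adjoint W * W = \<Gamma> * (mat_adjoint (U t) * (U t * mat_adjoint \<Gamma>))"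
      using assoc_mult_mat[OF \<Gamma>C(1) mat_adjoint_carrier[OF UC] W] by (simp add: W_def)
    also have "mat_adjoint (U t) * (U t * mat_adjoint \<Gamma>) = (mat_adjoint (U t) * U t) * mat_adjoint \<Gamma>"
      by (rule assoc_mult_mat[symmetric, OF mat_adjoint_carrier[OF UC] UC mat_adjoint_carrier[OF \<Gamma>C(1)]])
    also have "\<Gamma> * \<dots> = 1\<^sub>m (2 ^ n)"
      unfolding UU using \<Gamma>C by simp
    finally have "mat_adjoint W * W = 1\<^sub>m (2 ^ n)" .
    then have "op_norm (commutator W (H 0)) \<le> 2 * op_norm (H 0)"
      by (intro op_norm_commutator_isometry_le[OF H0 W]) auto
    \<comment> \<open>Nonnegativity is what allows the inequality to be squared.\<close>
    moreover have "0 \<le> op_norm (commutator W (H 0))"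
      using H0 W by (intro op_norm_nonneg[of _ "2 ^ n" "2 ^ n"])
        (auto simp: commutator_def intro!: minus_carrier_mat mult_carrier_mat)
    ultimately show ?thesis
      using True power_mono[of "op_norm (commutator W (H 0))" "2 * op_norm (H 0)" 2] by (simp add: W_def)
  qed (use after[of t] t in auto)
  then have "(\<integral>t. (op_norm (commutator (U t * mat_adjoint \<Gamma>) (H 0)))\<^sup>2 \<partial>lebesgue_on {0..T}) \<le> (2 * op_norm (H 0))\<^sup>2 * s"
    by (rule integral_lebesgue_on_le) (use s in auto)
  then show ?thesis
    using value_function_le[OF u U, of \<Gamma>] by (simp add: power_mult_distrib)
qed

text \<open>The bound holds for every time \<open>s\<close> at which \<open>\<Gamma>\<close> is
  reached and is linear in \<open>s\<close>, so the infimum over \<open>s\<close> can be taken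
  afterwards.\<close>

lemma value_function_le_reachable:
  assumes H: "\<And>j. j \<in> {0..m} \<Longrightarrow> self_adjoint_op n (H j)" and \<Gamma>: "unitary_op n \<Gamma>"
    and reach: "reachable_at n M m H s \<Gamma>" and "0 < s" "0 < T" "0 \<le> M"
  shows "value_function n M m H T \<Gamma> \<le> 2 * (op_norm (H 0))\<^sup>2 * s"
proof -
  obtain u U where u: "u \<in> admissible_controls M m s" and U: "propagator n m H u s U" and Us: "U s = \<Gamma>"
    using reach by (auto simp: reachable_at_def)
  have H0: "H 0 \<in> carrier_mat (2 ^ n) (2 ^ n)"
    using H[of 0] by (simp add: self_adjoint_op_def)
  \<comment> \<open>After time \<open>s\<close> the controls are switched off, and \<open>U(t) \<Gamma>\<^sup>*\<close> is a function of \<open>H\<^sub>0\<close>.\<close>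
  show ?thesis
  proof (cases "T \<le> s")
    case True
    \<comment> \<open>Here \<open>T\<close> itself is the time after which the integrand has to
      vanish, so that condition is vacuous.\<close>
    have "value_function n M m H T \<Gamma> \<le> 2 * (op_norm (H 0))\<^sup>2 * T"
      using True \<open>0 < T\<close> admissible_controls_restrict[OF u True] propagator_restrict[OF U _ True]
      by (intro value_function_le_if_commute_after[OF H \<Gamma>]) auto
    also have "\<dots> \<le> 2 * (op_norm (H 0))\<^sup>2 * s"
      using True by (intro mult_left_mono) auto
    finally show ?thesis .
  next
    case False
    show ?thesis
    proof (rule value_function_le_if_commute_after[OF H \<Gamma>])
      show "(\<lambda>j t. if t \<le> s then u j t else 0) \<in> admissible_controls M m T"
        using False assms by (intro admissible_controls_extend[OF u]) auto
      show "propagator n m H (\<lambda>j t. if t \<le> s then u j t else 0) T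
          (\<lambda>t. if t \<le> s then U t else exp_flow (H 0) (t - s) * U s)"
        using False assms(4) by (intro propagator_extend[OF U _ _ H0]) auto
      fix t assume t: "s < t"
      have G: "\<Gamma> \<in> carrier_mat (2 ^ n) (2 ^ n)" "\<Gamma> * mat_adjoint \<Gamma> = 1\<^sub>m (2 ^ n)"
        using \<Gamma> by (auto simp: unitary_op_def)
      \<comment> \<open>Since \<open>U s = \<Gamma>\<close>, the target cancels and the pure free
        evolution is left.\<close>
      have "exp_flow (H 0) (t - s) * \<Gamma> * mat_adjoint \<Gamma> = exp_flow (H 0) (t - s)"
        using assoc_mult_mat[OF exp_flow_carrier[OF H0] G(1) mat_adjoint_carrier[OF G(1)], of "t - s"] G(2)
          right_mult_one_mat[OF exp_flow_carrier[OF H0], of "t - s"] by simp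
      moreover have "commutator (exp_flow (H 0) (t - s)) (H 0) = 0\<^sub>m (2 ^ n) (2 ^ n)"
        unfolding commutator_def exp_flow_commute[OF H0]
        by (rule minus_r_inv_mat[OF mult_carrier_mat[OF H0 exp_flow_carrier[OF H0]]])
      ultimately show "op_norm (commutator ((if t \<le> s then U t else exp_flow (H 0) (t - s) * U s) * mat_adjoint \<Gamma>) (H 0)) = 0"
        using t Us by (simp add: op_norm_zero)
    qed (use False \<open>0 < s\<close> in auto)
  qed
qed

theorem proposition9:
  fixes n :: nat and M :: real and m :: "nat \<Rightarrow> nat"
    and H :: "nat \<Rightarrow> nat \<Rightarrow> complex mat" and \<Gamma> :: "nat \<Rightarrow> complex mat"
    and C :: real and p :: int and T :: real
  assumes "n \<ge> 1"
    and "M > 0"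
    and "\<And>j. j \<in> {0..m n} \<Longrightarrow> self_adjoint_op n (H n j)"
    and "special_unitary_op n (\<Gamma> n)"
    and "operator_controllable n M (m n) (H n)"
    and "quantum_advantage M m H \<Gamma> C p"
    and "T > 0"
  shows "value_function n M (m n) (H n) T (\<Gamma> n)
    \<le> 2 * (op_norm (H n 0))\<^sup>2 * C * real n powi p"
proof -
  define V where "V = value_function n M (m n) (H n) T (\<Gamma> n)"
  define k where "k = 2 * (op_norm (H n 0))\<^sup>2"
  define S where "S = {s. s > 0 \<and> reachable_at n M (m n) (H n) s (\<Gamma> n)}"
  \<comment> \<open>Both facts are Quantum Advantage at the given \<open>n\<close>; nonemptiness
    makes \<open>Inf S\<close> a true greatest lower bound.\<close>
  have "S \<noteq> {}" and Inf_le: "Inf S \<le> C * real n powi p"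
    using assms(1,6) by (auto simp: quantum_advantage_def T_min_def S_def)
  have unitary: "unitary_op n (\<Gamma> n)" using assms(4) by (simp add: special_unitary_op_def)
  have V: "V \<le> k * s" if "s \<in> S" for s
    unfolding V_def k_def
    using that assms(2,7) by (intro value_function_le_reachable assms(3) unitary) (auto simp: S_def)
  have "k \<ge> 0" by (simp add: k_def)
  have "V \<le> k * Inf S"
  \<comment> \<open>Dividing by \<open>k\<close> turns the bounds into a lower bound of
    \<open>S\<close>. For \<open>k = 0\<close> any element of \<open>S\<close> already gives
    \<open>V \<le> 0\<close>.\<close>
  proof (cases "k = 0")
    case True
    then show ?thesis using V \<open>S \<noteq> {}\<close> by auto
  next
    case False
    with \<open>k \<ge> 0\<close> have "V / k \<le> Inf S"
      using V by (intro cInf_greatest[OF \<open>S \<noteq> {}\<close>]) (simp add: field_simps)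
    with False \<open>k \<ge> 0\<close> show ?thesis by (simp add: field_simps)
  qed
  also have "\<dots> \<le> k * (C * real n powi p)"
    using Inf_le \<open>k \<ge> 0\<close> by (rule mult_left_mono)
  finally show ?thesis by (simp add: V_def k_def mult.assoc)
qed

end
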